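(* Let $n\ge 3$ be an integer and let $\mathcal{X}\subseteq\mathbb{C}$ be a perfect space such that for every $\mathbf{x}\in\mathcal{C}^n(\mathcal{X})$ the graph $\Gamma^n(\mathbf{x})$ contains an $n$-cycle. Assume furthermore that - the symmetric group $S_n$ acts transitively on the set of connected components of $\mathcal{C}^n(\mathcal{X})$; and - that action is not free (i.e. the isotropy groups are not trivial). Then the continuous CS preservers $\phi:\sigma^-_\perp(\mathcal{X})\to M_n(\mathbb{C})$ are precisely the (restrictions to $\sigma^-_\perp(\mathcal{X})$ of) conjugations $A\mapsto TAT^{-1}$ and transpose conjugations $A\mapsto TA^tT^{-1}$ by elements $T\in\mathrm{GL}_n(\mathbb{C})$.
   Context: A topological space $\mathcal{X}$ is perfect if every $x\in\mathcal{X}$ lies in the closure of $\mathcal{X}\setminus\{x\}$ (subsets of $\mathbb{C}$ carry the subspace topology; closedness in $\mathbb{C}$ is not required). $\sigma(T)$ is the spectrum (set of eigenvalues) of $T\in M_n(\mathbb{C})$, and $\sigma^-_\perp(\mathcal{X})$ is the set of normal matrices $T\in M_n(\mathbb{C})$ with $\sigma(T)\subseteq\mathcal{X}$. A CS (commutativity and spectrum) preserver on a set $\mathcal{S}\subseteq M_n(\mathbb{C})$ is a map $\phi:\mathcal{S}\to M_n(\mathbb{C})$ (not assumed linear) with $\sigma(\phi(A))=\sigma(A)$ for all $A\in\mathcal{S}$, and $\phi(A)\phi(B)=\phi(B)\phi(A)$ whenever $A,B\in\mathcal{S}$ and $AB=BA$. $\mathcal{C}^n(\mathcal{X})=\{(x_1,\dots,x_n)\in\mathcal{X}^n: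 x_i\text{ distinct}\}$ with the topology induced from $\mathcal{X}^n$. $S_n$ acts on $\mathcal{X}^n$ and $\mathcal{C}^n(\mathcal{X})$ on the right by $(x_i)_i\triangleleft\theta=(x_{\theta i})_i$, hence also on the set of connected components of $\mathcal{C}^n(\mathcal{X})$. For $\mathbf{x}\in\mathcal{X}^n$, the set of coincidences $\mathcal{E}^n(\mathbf{x})$ is the set of pairs $\{i\ne j\}\subseteq\{1,\dots,n\}$ with $x_i=x_j$. For a connected component $\mathcal{C}\subseteq\mathcal{C}^n(\mathcal{X})$, $\Gamma^n(\mathcal{C})$ is the loop-free undirected graph with vertex set $\{1,\dots,n\}$ and with an edge $\{i\neq j\}$ exactly when there is a point $\mathbf{y}\in\mathcal{X}^n$ lying in both $\overline{\mathcal{C}}$ and $\overline{\mathcal{C}\triangleleft(i\,j)}$ (closures in $\mathcal{X}^n$; $(i\,j)$ the transposition) whose only coincidence is $\{i,j\}$, i.e. $\mathcal{E}^n(\mathbf{y})=\{\{i,j\}\}$. For $\mathbf{x}\in\mathcal{C}^n(\mathcal{X})$, $\Gamma^n(\mathbf{x}):=\Gamma^n(\mathcal{C})$ for the connected component $\mathcal{C}$ containing $\mathbf{x}$. *)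

theory Defs
  imports "HOL-Analysis.Analysis" "HOL-Combinatorics.Combinatorics"
begin

(* The index set {1..n} is an arbitrary finite type 'n, with n = CARD('n);
   M_n(C) is complex^'n^'n, and S_n is the set of \<theta> with \<theta> permutes UNIV. *)

definition perfect_set :: "complex set \<Rightarrow> bool" where
  "perfect_set X \<longleftrightarrow> (\<forall>x\<in>X. x \<in> top_of_set X closure_of (X - {x}))"


section \<open>Matrices\<close>

(* The name transpose also denotes a transposition of two points. *)
abbreviation mat_transpose :: "complex^'n^'n \<Rightarrow> complex^'n^'n" where
  "mat_transpose \<equiv> Finite_Cartesian_Product.transpose"

definition conj_transpose :: "complex^'n^'n \<Rightarrow> complex^'n^'n" where
  "conj_transpose A = (\<chi> i j. cnj (A $ j $ i))"

definition normal_matrix :: "complex^'n^'n \<Rightarrow> bool" where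
  "normal_matrix A \<longleftrightarrow> A ** conj_transpose A = conj_transpose A ** A"

definition spectrum :: "complex^'n^'n \<Rightarrow> complex set" where
  "spectrum A = {c. \<exists>v. v \<noteq> 0 \<and> A *v v = c *s v}"

definition normal_matrices :: "complex set \<Rightarrow> (complex^'n^'n) set" where
  "normal_matrices X = {A. normal_matrix A \<and> spectrum A \<subseteq> X}"

(* Maps on S are total functions of which only the values on S matter. *)
definition CS_preserver ::
  "(complex^'n^'n) set \<Rightarrow> (complex^'n^'n \<Rightarrow> complex^'n^'n) \<Rightarrow> bool" where
  "CS_preserver S \<phi> \<longleftrightarrow>
     (\<forall>A\<in>S. spectrum (\<phi> A) = spectrum A) \<and>
     (\<forall>A\<in>S. \<forall>B\<in>S. A ** B = B ** A \<longrightarrow> \<phi> A ** \<phi> B = \<phi> B ** \<phi> A)"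


section \<open>Configuration spaces\<close>

definition power_space :: "complex set \<Rightarrow> (complex^'n) set" where
  "power_space X = {x. \<forall>i. x $ i \<in> X}"

definition config_space :: "complex set \<Rightarrow> (complex^'n) set" where
  "config_space X = {x \<in> power_space X. \<forall>i j. i \<noteq> j \<longrightarrow> x $ i \<noteq> x $ j}"

definition perm_act :: "complex^'n \<Rightarrow> ('n \<Rightarrow> 'n) \<Rightarrow> complex^'n" (infixl "\<triangleleft>" 70) where
  "x \<triangleleft> \<theta> = (\<chi> i. x $ \<theta> i)"

definition perm_act_set :: "(complex^'n) set \<Rightarrow> ('n \<Rightarrow> 'n) \<Rightarrow> (complex^'n) set"
    (infixl "\<triangleleft>\<triangleleft>" 70) where
  "C \<triangleleft>\<triangleleft> \<theta> = (\<lambda>x. x \<triangleleft> \<theta>) ` C"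

definition transitive_on_components :: "(complex^'n) set \<Rightarrow> bool" where
  "transitive_on_components S \<longleftrightarrow>
     (\<forall>C\<in>components S. \<forall>D\<in>components S. \<exists>\<theta>. \<theta> permutes UNIV \<and> C \<triangleleft>\<triangleleft> \<theta> = D)"

definition free_on_components :: "(complex^'n) set \<Rightarrow> bool" where
  "free_on_components S \<longleftrightarrow>
     (\<forall>C\<in>components S. \<forall>\<theta>. \<theta> permutes UNIV \<and> C \<triangleleft>\<triangleleft> \<theta> = C \<longrightarrow> \<theta> = id)"

definition coincidences :: "complex^'n \<Rightarrow> 'n set set" where
  "coincidences x = {{i, j} | i j. i \<noteq> j \<and> x $ i = x $ j}"


section \<open>Graphs\<close>

(* A loop-free undirected graph with vertex set UNIV is given by its set of
   edges, each of them a two-element set. *)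
definition component_graph :: "complex set \<Rightarrow> (complex^'n) set \<Rightarrow> 'n set set" where
  "component_graph X C =
     {{i, j} | i j. i \<noteq> j \<and>
        (\<exists>y \<in> power_space X.
           y \<in> top_of_set (power_space X) closure_of C \<and>
           y \<in> top_of_set (power_space X) closure_of
                 (C \<triangleleft>\<triangleleft> Transposition.transpose i j) \<and>
           coincidences y = {{i, j}})}"

definition point_graph :: "complex set \<Rightarrow> complex^'n \<Rightarrow> 'n set set" where
  "point_graph X x = component_graph X (connected_component_set (config_space X) x)"

definition contains_cycle :: "nat \<Rightarrow> 'v set set \<Rightarrow> bool" where
  "contains_cycle k E \<longleftrightarrow>
     3 \<le> k \<and> (\<exists>vs. length vs = k \<and> distinct vs \<and>
               (\<forall>m<k. {vs ! m, vs ! (Suc m mod k)} \<in> E))"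

end

theory Submission
  imports Defs "HOL-Computational_Algebra.Fundamental_Theorem_Algebra"
begin

text \<open>
  For a point x of the configuration space and a unitary U, the matrix \<phi>(U diag(x) U*) has simple
  spectrum, so it is a combination with coefficients given by a permutation of x of rank-one
  idempotents P_i(U), which are Lagrange polynomials in \<phi>(U diag(x0) U*) for a fixed x0. By
  connectedness the permutation depends neither on U nor on x within a component. The action of
  S_n on columns and components turns these permutations into an endomorphism \<rho> of S_n; an edge
  (i j) of the graph forces \<rho>(i j) to be (i j) or the identity, and a nontrivial isotropy group
  forces \<rho> to be nontrivial, whence \<rho> is the identity and all permutations are trivial.

  By density and by evaluating at points with only two distinct coordinates, P_i(U) = Q(u_i) depends only on
  the i-th column of U. Thus the map u \<mapsto> range of Q(u) on lines carries orthogonal frames to bases, and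
  the image of a sum of orthogonal vectors lies in the span of their images. A connectedness
  argument in the complex line shows that the map on lines is injective; then coordinate ratios
  give a multiplicative function h on the complex numbers, and orthogonal decompositions make h additive.
  As h is continuous, it is the identity or complex conjugation, so the map on lines is induced
  by a linear or a conjugate-linear bijection.
\<close>

subsection \<open>Matrices and polynomials in a matrix\<close>

text \<open>A permutation attached to a configuration has a meaning only relative to a labelling of
  the lines, fixed here at one base point \<open>x0\<close>. The same normal matrix arises when the
  columns of U and the coordinates of x are permuted alike, and comparing the two labellings is what
  produces \<rho>. A trivial \<rho> would mean that the labelling ignores the order of the columns;
  an isotropy element \<theta> excludes this because \<rho>(\<theta>) is then conjugate to \<theta>.

  In the second half the obstacle is that carrying frames to bases says nothing direct about two
  distinct lines that are not orthogonal: they could have the same image. Nor does the fundamental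
  theorem of projective geometry apply at once, since only sums of orthogonal vectors are
  controlled. Injectivity is used in the sharp form that a coordinate of an image vanishes exactly
  when that of the vector does, which makes coordinate ratios meaningful. Ratios compose along three
  distinct indices, and three coordinates also carry the orthogonal vectors (1, -y, y) and (0, x, x)
  behind additivity.\<close>

lemma mat_mult_nth: "(mat c ** A) $ i $ j = c * A $ i $ j"
  for A :: "complex^'m^'n"
proof -
  have "(\<Sum>k\<in>UNIV. (if i = k then c else 0) * A $ k $ j) = (\<Sum>k\<in>UNIV. if i = k then c * A $ k $ j else 0)"
    by (intro sum.cong) auto
  then show ?thesis
    by (simp add: matrix_matrix_mult_def mat_def)
qed

lemma mult_mat_nth: "(A ** mat c) $ i $ j = c * A $ i $ j"
  for A :: "complex^'n^'m"
proof -
  have "(\<Sum>k\<in>UNIV. A $ i $ k * (if k = j then c else 0)) = (\<Sum>k\<in>UNIV. if k = j then c * A $ i $ k else 0)"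
    by (intro sum.cong) auto
  then show ?thesis
    by (simp add: matrix_matrix_mult_def mat_def)
qed

lemma mat_mult_commute: "mat c ** A = A ** mat c" for A :: "complex^'n^'n"
  by (simp add: vec_eq_iff mat_mult_nth mult_mat_nth)

lemma mat_mult_vec [simp]: "mat c *v v = c *s v" for v :: "complex^'n"
proof -
  have "(\<Sum>j\<in>UNIV. (if i = j then c else 0) * v $ j) = (\<Sum>j\<in>UNIV. if i = j then c * v $ j else 0)" for i
    by (intro sum.cong) auto
  then show ?thesis
    by (simp add: vec_eq_iff matrix_vector_mult_def mat_def)
qed

lemma mat_add: "mat (a + b) = (mat a + mat b :: complex^'n^'n)"
  by (simp add: vec_eq_iff mat_def)

lemma mat_mult_mat: "mat a ** mat b = (mat (a * b) :: complex^'n^'n)"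
  by (simp add: vec_eq_iff mat_mult_nth) (simp add: mat_def)

lemma matrix_vector_mult_scale: "A *v (c *s v) = c *s (A *v v)" for A :: "complex^'n^'m"
  by (simp add: vec_eq_iff matrix_vector_mult_def sum_distrib_left mult_ac)

lemma matrix_vector_mult_sum_right: "A *v (\<Sum>i\<in>I. f i) = (\<Sum>i\<in>I. A *v f i)" for A :: "complex^'n^'m"
  by (induction I rule: infinite_finite_induct) (auto simp: matrix_vector_right_distrib)

lemma matrix_vector_mult_sum_left: "(\<Sum>i\<in>I. F i) *v v = (\<Sum>i\<in>I. F i *v v)"
  for F :: "'i \<Rightarrow> complex^'n^'m"
  by (induction I rule: infinite_finite_induct) (auto simp: matrix_vector_mult_add_rdistrib)

lemma matrix_mult_add_right: "(A + B) ** C = A ** C + B ** C" for A :: "complex^'n^'m"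
  by (simp add: vec_eq_iff matrix_matrix_mult_def sum.distrib algebra_simps)

lemma matrix_mult_column: "column j (A ** B) = A *v column j B"
  for A :: "complex^'n^'m"
  by (simp add: vec_eq_iff column_def matrix_matrix_mult_def matrix_vector_mult_def)

lemma matrix_eqI_columns: "(\<And>j. column j A = column j B) \<Longrightarrow> A = B"
  by (simp add: vec_eq_iff column_def)

lemma matrix_vector_mult_axis: "A *v axis j 1 = column j A" for A :: "complex^'n^'m"
  by (simp add: vec_eq_iff matrix_vector_mult_def column_def axis_def if_distrib[of "\<lambda>x. _ * x"] cong: if_cong)

lemma matrix_eq_on_columns:
  fixes A B :: "complex^'n^'n"
  assumes "invertible V" "\<And>j. A *v column j V = B *v column j V"
  shows "A = B"
proof -
  have "A ** V = B ** V"
    by (rule matrix_eqI_columns) (simp add: matrix_mult_column assms(2))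
  then show ?thesis
    using assms(1) by (metis invertible_def matrix_mul_assoc matrix_mul_rid)
qed

lemma invertible_iff_trivial_kernel:
  fixes A :: "complex^'n^'n"
  shows "invertible A \<longleftrightarrow> (\<forall>v. A *v v = 0 \<longrightarrow> v = 0)"
  by (metis invertible_left_inverse matrix_left_invertible_ker)

lemma invertible_matrix_inv:
  fixes A :: "complex^'n^'n"
  assumes "invertible A"
  shows "A ** matrix_inv A = mat 1" "matrix_inv A ** A = mat 1"
  using someI_ex[OF assms[unfolded invertible_def]] by (auto simp: matrix_inv_def)

section \<open>Hermitian inner product and adjoints\<close>

definition cinner :: "complex^'n \<Rightarrow> complex^'n \<Rightarrow> complex" where
  "cinner x y = (\<Sum>i\<in>UNIV. cnj (x $ i) * y $ i)"

lemma cinner_add_right: "cinner x (y + z) = cinner x y + cinner x z"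
  by (simp add: cinner_def sum.distrib algebra_simps)

lemma cinner_add_left: "cinner (x + y) z = cinner x z + cinner y z"
  by (simp add: cinner_def sum.distrib algebra_simps)

lemma cinner_diff_right: "cinner x (y - z) = cinner x y - cinner x z"
  by (simp add: cinner_def sum_subtractf algebra_simps)

lemma cinner_diff_left: "cinner (x - y) z = cinner x z - cinner y z"
  by (simp add: cinner_def sum_subtractf algebra_simps)

lemma cinner_scale_right: "cinner x (c *s y) = c * cinner x y"
  by (simp add: cinner_def sum_distrib_left algebra_simps)

lemma cinner_scale_left: "cinner (c *s x) y = cnj c * cinner x y"
  by (simp add: cinner_def sum_distrib_left algebra_simps)

lemma cinner_zero [simp]: "cinner x 0 = 0" "cinner 0 x = 0"
  by (simp_all add: cinner_def)

lemma cnj_cinner: "cnj (cinner x y) = cinner y x"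
  by (simp add: cinner_def cnj_sum mult.commute)

lemma cinner_commute_zero: "cinner x y = 0 \<longleftrightarrow> cinner y x = 0"
  by (metis cnj_cinner complex_cnj_zero)

lemma cinner_self: "cinner x x = of_real ((norm x)\<^sup>2)"
proof -
  have "cnj z * z = of_real ((norm z)\<^sup>2)" for z
    by (metis complex_norm_square mult.commute)
  then have "cinner x x = of_real (\<Sum>i\<in>UNIV. (norm (x $ i))\<^sup>2)"
    by (simp add: cinner_def)
  also have "(\<Sum>i\<in>UNIV. (norm (x $ i))\<^sup>2) = (norm x)\<^sup>2"
    by (simp add: norm_vec_def L2_set_def sum_nonneg)
  finally show ?thesis .
qed

lemma cinner_self_eq_0 [simp]: "cinner x x = 0 \<longleftrightarrow> x = 0"
  by (simp add: cinner_self)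

lemma cinner_self_eq_1: "cinner x x = 1 \<longleftrightarrow> norm x = 1"
proof -
  have "cinner x x = 1 \<longleftrightarrow> (norm x)\<^sup>2 = 1"
    by (simp only: cinner_self of_real_eq_1_iff)
  then show ?thesis
    by (simp add: abs_square_eq_1)
qed

lemma cinner_axis [simp]: "cinner (axis i 1) x = x $ i" "cinner x (axis i 1) = cnj (x $ i)"
  by (simp_all add: cinner_def axis_def if_distrib[of "\<lambda>x. _ * x"] if_distrib[of "\<lambda>x. x * _"]
      if_distrib[of cnj] cong: if_cong)

lemma scaleR_eq_scale: "r *\<^sub>R x = of_real r *s x" for x :: "complex^'n"
  by (simp add: vec_eq_iff) (simp add: scaleR_conv_of_real)

lemma cinner_adjoint: "cinner x (A *v y) = cinner (conj_transpose A *v x) y"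
proof -
  have "cinner x (A *v y) = (\<Sum>i\<in>UNIV. \<Sum>j\<in>UNIV. cnj (x $ i) * A $ i $ j * y $ j)"
    by (simp add: cinner_def matrix_vector_mult_def sum_distrib_left mult_ac)
  also have "\<dots> = (\<Sum>j\<in>UNIV. \<Sum>i\<in>UNIV. cnj (x $ i) * A $ i $ j * y $ j)"
    by (rule sum.swap)
  also have "\<dots> = cinner (conj_transpose A *v x) y"
    by (simp add: cinner_def matrix_vector_mult_def conj_transpose_def sum_distrib_left
        sum_distrib_right mult_ac)
  finally show ?thesis .
qed

lemma conj_transpose_mult: "conj_transpose (A ** B) = conj_transpose B ** conj_transpose A"
  by (simp add: vec_eq_iff conj_transpose_def matrix_matrix_mult_def mult.commute)

lemma conj_transpose_twice [simp]: "conj_transpose (conj_transpose A) = A"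
  by (simp add: vec_eq_iff conj_transpose_def)

lemma conj_transpose_mat: "conj_transpose (mat c) = mat (cnj c)"
  by (simp add: vec_eq_iff conj_transpose_def mat_def)

text \<open>Since A - c commutes with its adjoint, the vectors (A* - cnj c) v and (A - c) v have the
  same norm.\<close>

lemma normal_adjoint_eigenvector:
  assumes "normal_matrix A" "A *v v = c *s v"
  shows "conj_transpose A *v v = cnj c *s v"
proof -
  define B where "B = conj_transpose A"
  have comm: "A *v (B *v w) = B *v (A *v w)" for w
    using assms(1) by (simp add: normal_matrix_def B_def matrix_vector_mul_assoc)
  have adj: "cinner (B *v x) y = cinner x (A *v y)" "cinner (A *v x) y = cinner x (B *v y)" for x y
    using cinner_adjoint[of x A y] cinner_adjoint[of x B y] by (simp_all add: B_def)
  have "cinner (B *v v - cnj c *s v) (B *v v - cnj c *s v) =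
        cinner (A *v v - c *s v) (A *v v - c *s v)"
  proof -
    have e1: "cinner (B *v v) (B *v v) = cinner (A *v v) (A *v v)"
      by (metis adj comm)
    have e2: "cinner (B *v v) v = cinner v (A *v v)" "cinner v (B *v v) = cinner (A *v v) v"
      by (simp_all add: adj)
    show ?thesis
      unfolding cinner_diff_right cinner_diff_left cinner_scale_right cinner_scale_left e1 e2
      by (simp add: algebra_simps)
  qed
  then show ?thesis
    by (simp add: assms(2) B_def)
qed

section \<open>Polynomials evaluated at a matrix, and eigenvectors in invariant subspaces\<close>

definition matpoly :: "complex poly \<Rightarrow> complex^'n^'n \<Rightarrow> complex^'n^'n" where
  "matpoly p A = fold_coeffs (\<lambda>a N. mat a + A ** N) p 0"

lemma matpoly_0 [simp]: "matpoly 0 A = 0"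
  by (simp add: matpoly_def)

lemma matpoly_pCons [simp]: "matpoly (pCons a p) A = mat a + A ** matpoly p A"
  by (cases "a = 0 \<and> p = 0") (auto simp: matpoly_def)

lemma matpoly_add: "matpoly (p + q) A = matpoly p A + matpoly q A"
  by (induction p q rule: poly_induct2) (simp_all add: mat_add matrix_add_ldistrib)

lemma matpoly_smult: "matpoly (smult c p) A = mat c ** matpoly p A"
  by (induction p) (simp_all add: matrix_add_ldistrib mat_mult_mat matrix_mul_assoc mat_mult_commute[of c A])

lemma matpoly_mult: "matpoly (p * q) A = matpoly p A ** matpoly q A"
  by (induction p)
    (simp_all add: matpoly_add matpoly_smult matrix_mul_assoc matrix_mult_add_right)

lemma matpoly_sum: "matpoly (sum f S) A = (\<Sum>k\<in>S. matpoly (f k) A)"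
  by (induction S rule: infinite_finite_induct) (auto simp: matpoly_add)

lemma matpoly_monom: "matpoly (monom c k) A *v w = c *s (((*v) A ^^ k) w)"
proof (induction k)
  case (Suc k)
  then show ?case
    by (simp add: monom_Suc flip: matrix_vector_mul_assoc) (simp add: matrix_vector_mult_scale)
qed (simp add: monom_0)

lemma matpoly_eigenvector:
  assumes "A *v v = c *s v"
  shows "matpoly p A *v v = poly p c *s v"
proof (induction p)
  case (pCons a p)
  have "matpoly (pCons a p) A *v v = a *s v + A *v (matpoly p A *v v)"
    by (simp add: matrix_vector_mult_add_rdistrib matrix_vector_mul_assoc)
  also have "\<dots> = a *s v + (c * poly p c) *s v"
    by (simp add: pCons matrix_vector_mult_scale assms vector_smult_assoc mult.commute)
  finally show ?case
    by (simp add: vector_sadd_rdistrib)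
qed simp

lemma continuous_on_matrix_mult [continuous_intros]:
  fixes F :: "'t::topological_space \<Rightarrow> complex^'n^'m" and G :: "'t \<Rightarrow> complex^'k^'n"
  assumes "continuous_on S F" "continuous_on S G"
  shows "continuous_on S (\<lambda>t. F t ** G t)"
  unfolding matrix_matrix_mult_def
  by (intro continuous_intros assms)

lemma continuous_on_matrix_vector_mult [continuous_intros]:
  fixes F :: "'t::topological_space \<Rightarrow> complex^'n^'m" and G :: "'t \<Rightarrow> complex^'n"
  assumes "continuous_on S F" "continuous_on S G"
  shows "continuous_on S (\<lambda>t. F t *v G t)"
  unfolding matrix_vector_mult_def
  by (intro continuous_intros assms)

lemma continuous_on_scale [continuous_intros]:
  fixes f :: "'t::topological_space \<Rightarrow> complex" and G :: "'t \<Rightarrow> complex^'n"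
  assumes "continuous_on S f" "continuous_on S G"
  shows "continuous_on S (\<lambda>t. f t *s G t)"
  unfolding vector_scalar_mult_def
  by (intro continuous_intros assms)

lemma continuous_on_mat [continuous_intros]:
  fixes f :: "'t::topological_space \<Rightarrow> complex"
  assumes "continuous_on S f"
  shows "continuous_on S (\<lambda>t. mat (f t) :: complex^'n^'n)"
  unfolding mat_def
proof (intro continuous_intros)
  show "continuous_on S (\<lambda>t. if i = j then f t else 0)" for i j :: 'n
    using assms by (cases "i = j") (auto intro: continuous_intros)
qed

lemma continuous_on_matpoly [continuous_intros]:
  assumes "continuous_on S F"
  shows "continuous_on S (\<lambda>t. matpoly p (F t))"
  by (induction p) (auto intro!: continuous_intros assms)

lemma matpoly_invariant:
  assumes "\<And>w. w \<in> W \<Longrightarrow> A *v w \<in> W" "vec.subspace W" "w \<in> W"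
  shows "matpoly p A *v w \<in> W"
proof (induction p)
  case (pCons a p)
  have "matpoly (pCons a p) A *v w = a *s w + A *v (matpoly p A *v w)"
    by (simp add: matrix_vector_mult_add_rdistrib matrix_vector_mul_assoc)
  then show ?case
    using pCons assms by (simp add: vec.subspace_add vec.subspace_scale)
qed (simp add: vec.subspace_0[OF assms(2)])

text \<open>In dimension n the n + 1 iterates w, A w, ..., A^n w satisfy a linear relation, whose
  coefficients form the polynomial.\<close>

lemma ex_annihilating_poly:
  fixes A :: "complex^'n^'n"
  obtains p where "p \<noteq> 0" "matpoly p A *v w = 0"
proof -
  define a where "a k = ((*v) A ^^ k) w" for k
  show thesis
  proof (cases "inj_on a {..CARD('n)}")
    \<comment> \<open>A repetition among the iterates is invisible to the independence of the set
      they form, so it is treated on its own.\<close>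
    case False
    then obtain j k where jk: "j \<noteq> k" "a j = a k"
      by (auto simp: inj_on_def)
    have "monom 1 j - monom 1 k \<noteq> (0 :: complex poly)"
      using jk(1) by (metis coeff_monom eq_iff_diff_eq_0 zero_neq_one)
    moreover have "matpoly (monom 1 j + monom (-1) k) A *v w = 0"
      using jk(2) unfolding matpoly_add matrix_vector_mult_add_rdistrib matpoly_monom
      by (simp add: a_def vector_smult_lneg)
    ultimately show thesis
      using that[of "monom 1 j + monom (-1) k"] by (simp add: minus_monom[symmetric])
  next
    case True
    have "\<not> vec.independent (a ` {..CARD('n)})"
    proof
      assume "vec.independent (a ` {..CARD('n)})"
      then have "card (a ` {..CARD('n)}) \<le> vec.dim (UNIV :: (complex^'n) set)"
        by (intro vec.independent_card_le_dim) auto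
      then show False
        using card_image[OF True] vec_dim_card[where 'n='n and 'a=complex] by simp
    qed
    then obtain u where u: "\<exists>v\<in>a ` {..CARD('n)}. u v \<noteq> 0" "(\<Sum>v\<in>a ` {..CARD('n)}. u v *s v) = 0"
      by (subst (asm) vec.dependent_finite) auto
    define p where "p = (\<Sum>k\<le>CARD('n). monom (u (a k)) k)"
    have "coeff p k = u (a k)" if "k \<le> CARD('n)" for k
      using that by (simp add: p_def coeff_sum)
    then have "p \<noteq> 0"
      using u(1) by force
    moreover have "matpoly p A *v w = (\<Sum>k\<le>CARD('n). u (a k) *s a k)"
      by (simp add: p_def matpoly_sum matrix_vector_mult_sum_left matpoly_monom a_def)
    moreover have "\<dots> = 0"
      using u(2) sum.reindex[OF True, of "\<lambda>v. u v *s v"] by simp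
    ultimately show thesis
      using that by simp
  qed
qed

text \<open>Take p of least degree with p(A) w = 0 and write p = (X - c) q. By minimality q(A) w is
  nonzero; it stays in \<open>W\<close>, and A - c kills it.\<close>

lemma ex_eigenvector_invariant_subspace:
  fixes A :: "complex^'n^'n"
  assumes W: "vec.subspace W" "\<And>w. w \<in> W \<Longrightarrow> A *v w \<in> W" and "w \<in> W" "w \<noteq> 0"
  obtains v c where "v \<in> W" "v \<noteq> 0" "A *v v = c *s v"
proof -
  define P where "P d \<longleftrightarrow> (\<exists>p. p \<noteq> 0 \<and> matpoly p A *v w = 0 \<and> degree p = d)" for d
  have "\<exists>d. P d"
    unfolding P_def using ex_annihilating_poly[of A w] by metis
  then have "P (LEAST d. P d)"
    by (rule LeastI_ex)
  then obtain p where p: "p \<noteq> 0" "matpoly p A *v w = 0" "degree p = (LEAST d. P d)"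
    by (auto simp: P_def)
  have "degree p \<noteq> 0"
  proof
    assume "degree p = 0"
    then obtain c where "p = [:c:]"
      using degree_eq_zeroE by blast
    then show False
      using p assms(4) by simp
  qed
  then obtain c where "poly p c = 0"
    using fundamental_theorem_of_algebra[of p] by (auto simp: constant_degree)
  then obtain q where q: "p = [:- c, 1:] * q"
    by (auto simp: poly_eq_0_iff_dvd)
  then have "q \<noteq> 0"
    using p(1) by auto
  then have "degree q < degree p"
    using q by (simp add: degree_mult_eq del: mult_pCons_left)
  then have "matpoly q A *v w \<noteq> 0"
    using not_less_Least[of "degree q" P] p(3) \<open>q \<noteq> 0\<close> by (auto simp: P_def)
  moreover have "matpoly q A *v w \<in> W"
    using matpoly_invariant assms by blast
  moreover have "matpoly p A = (mat (- c) + A ** mat 1) ** matpoly q A"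
    unfolding q matpoly_mult by simp
  then have "(mat (- c) + A) *v (matpoly q A *v w) = 0"
    using p(2) by (simp add: matrix_vector_mul_assoc)
  then have "A *v (matpoly q A *v w) = c *s (matpoly q A *v w)"
    by (simp add: matrix_vector_mult_add_rdistrib vector_smult_lneg)
  ultimately show thesis
    using that by blast
qed

section \<open>Unitary matrices and the spectral theorem\<close>

definition unitary :: "complex^'n^'n \<Rightarrow> bool" where
  "unitary U \<longleftrightarrow> conj_transpose U ** U = mat 1"

lemma unitary_columns:
  "unitary U \<longleftrightarrow> (\<forall>i j. cinner (column i U) (column j U) = (if i = j then 1 else 0))"
  by (simp add: unitary_def vec_eq_iff conj_transpose_def matrix_matrix_mult_def cinner_def
      column_def mat_def)

lemma unitary_right: "unitary U \<Longrightarrow> U ** conj_transpose U = mat 1"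
  unfolding unitary_def by (simp add: matrix_left_right_inverse)

lemma unitary_mat_1 [simp]: "unitary (mat 1)"
  by (simp add: unitary_def conj_transpose_mat)

lemma unitary_invertible: "unitary U \<Longrightarrow> invertible U"
  using invertible_left_inverse unitary_def by blast

text \<open>The conditions are the rows of a square matrix whose row \<open>k\<close> is zero, so
  the matrix is singular and has a kernel vector.\<close>

lemma ex_nonzero_orthogonal:
  fixes f :: "'n::finite \<Rightarrow> complex^'n"
  assumes "k \<notin> I"
  obtains w where "w \<noteq> 0" "\<And>i. i \<in> I \<Longrightarrow> cinner (f i) w = 0"
proof -
  define B :: "complex^'n^'n" where "B = (\<chi> i j. if i \<in> I then cnj (f i $ j) else 0)"
  have "\<not> invertible B"
  proof
    assume "invertible B"
    then obtain C where "B ** C = mat 1"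
      by (auto simp: invertible_def)
    then have "(B ** C) $ k $ k = 1"
      by (simp add: mat_def)
    then show False
      using assms by (simp add: B_def matrix_matrix_mult_def)
  qed
  then obtain w where w: "w \<noteq> 0" "B *v w = 0"
    by (auto simp: invertible_iff_trivial_kernel)
  have "cinner (f i) w = (B *v w) $ i" if "i \<in> I" for i
    using that by (simp add: B_def cinner_def matrix_vector_mult_def)
  then show thesis
    using that w by simp
qed

lemma norm_normalize:
  fixes v :: "complex^'n"
  assumes "v \<noteq> 0"
  shows "norm (complex_of_real (1 / norm v) *s v) = 1"
proof -
  have "norm ((1 / norm v) *\<^sub>R v) = 1"
    using assms by simp
  then show ?thesis
    by (simp only: scaleR_eq_scale)
qed

text \<open>Induction on the number of missing columns. By normality the given vectors are
  eigenvectors of the adjoint too, so their orthogonal complement is invariant and contains a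
  further eigenvector. Prescribing a partial family serves two ends: \<open>I\<close> empty gives
  the spectral theorem, and A = 1 extends any orthonormal family.\<close>

lemma normal_orthonormal_eigenbasis:
  fixes A :: "complex^'n^'n"
  assumes A: "normal_matrix A"
    and "\<And>i j. i \<in> I \<Longrightarrow> j \<in> I \<Longrightarrow> cinner (f i) (f j) = (if i = j then 1 else 0)"
    and "\<And>i. i \<in> I \<Longrightarrow> \<exists>c. A *v f i = c *s f i"
  obtains U where "unitary U" "\<And>i. i \<in> I \<Longrightarrow> column i U = f i"
    "\<And>i. \<exists>c. A *v column i U = c *s column i U"
proof -
  have "\<exists>U. unitary U \<and> (\<forall>i\<in>I. column i U = f i) \<and> (\<forall>i. \<exists>c. A *v column i U = c *s column i U)"
    using assms(2,3)
  proof (induction "card (- I)" arbitrary: I f)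
    case 0
    define U where "U = (\<chi> i j. f j $ i)"
    have "column i U = f i" for i
      by (simp add: U_def column_def vec_eq_iff)
    moreover have "I = UNIV"
      using 0(1) by auto
    ultimately have "unitary U" "\<forall>i\<in>I. column i U = f i" "\<forall>i. \<exists>c. A *v column i U = c *s column i U"
      using 0(2,3) by (simp_all add: unitary_columns)
    then show ?case
      by blast
  next
    case (Suc m)
    then have "- I \<noteq> {}"
      by (metis Zero_not_Suc card.empty)
    then obtain k where k: "k \<notin> I"
      by blast
    define W where "W = {w. \<forall>i\<in>I. cinner (f i) w = 0}"
    have "vec.subspace W"
      by (auto simp: W_def vec.subspace_def cinner_add_right cinner_scale_right)
    moreover have "A *v w \<in> W" if "w \<in> W" for w
      unfolding W_def
    proof safe
      fix i assume i: "i \<in> I"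
      then obtain c where "A *v f i = c *s f i"
        using Suc by blast
      then have "conj_transpose A *v f i = cnj c *s f i"
        using A normal_adjoint_eigenvector by blast
      then show "cinner (f i) (A *v w) = 0"
        using that i by (simp add: cinner_adjoint cinner_scale_left W_def)
    qed
    moreover obtain w where "w \<noteq> 0" "\<And>i. i \<in> I \<Longrightarrow> cinner (f i) w = 0"
      using ex_nonzero_orthogonal[OF k] by metis
    then have "w \<in> W" "w \<noteq> 0"
      by (auto simp: W_def)
    ultimately obtain v0 c where v0: "v0 \<in> W" "v0 \<noteq> 0" "A *v v0 = c *s v0"
      using ex_eigenvector_invariant_subspace by metis
    define v where "v = complex_of_real (1 / norm v0) *s v0"
    have v: "cinner v v = 1" "A *v v = c *s v"
      using norm_normalize[OF v0(2)] v0
      by (simp_all add: v_def cinner_self_eq_1 matrix_vector_mult_scale vector_smult_assoc mult.commute)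
    have ov: "cinner (f i) v = 0" "cinner v (f i) = 0" if "i \<in> I" for i
      using that v0(1) cinner_commute_zero[of v "f i"] by (auto simp: v_def W_def cinner_scale_right)
    define g where "g = f(k := v)"
    have "card (- insert k I) = m"
      using Suc(2) k by (metis ComplI Compl_insert card_Diff_singleton diff_Suc_1)
    moreover have "cinner (g i) (g j) = (if i = j then 1 else 0)" if "i \<in> insert k I" "j \<in> insert k I" for i j
      using that k ov v Suc(3) by (auto simp: g_def)
    moreover have "\<exists>c. A *v g i = c *s g i" if "i \<in> insert k I" for i
      using that k v Suc(4) by (auto simp: g_def)
    ultimately have "\<exists>U. unitary U \<and> (\<forall>i\<in>insert k I. column i U = g i) \<and> (\<forall>i. \<exists>c. A *v column i U = c *s column i U)"
      using Suc(1)[of "insert k I" g] by auto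
    then obtain U where "unitary U" "\<forall>i\<in>insert k I. column i U = g i" "\<forall>i. \<exists>c. A *v column i U = c *s column i U"
      by blast
    moreover have "column i U = f i" if "i \<in> I" for i
      using calculation(2) that k by (auto simp: g_def)
    ultimately show ?case
      by blast
  qed
  then show thesis
    using that by blast
qed

definition diag :: "complex^'n \<Rightarrow> complex^'n^'n" where
  "diag x = (\<chi> i j. if i = j then x $ i else 0)"

lemma diag_vec: "diag x *v v = (\<chi> i. x $ i * v $ i)"
  by (simp add: vec_eq_iff diag_def matrix_vector_mult_def if_distrib[of "\<lambda>x. x * _"] cong: if_cong)

lemma column_mult_diag: "column j (V ** diag x) = x $ j *s column j V"
  by (simp add: vec_eq_iff column_def diag_def matrix_matrix_mult_def if_distrib[of "\<lambda>x. _ * x"] mult.commute cong: if_cong)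

lemma diag_mult: "diag x ** diag y = diag (\<chi> i. x $ i * y $ i)"
  by (rule matrix_eqI_columns)
    (simp add: column_mult_diag, simp add: column_def vec_eq_iff diag_def)

lemma conj_transpose_diag: "conj_transpose (diag x) = diag (\<chi> i. cnj (x $ i))"
  by (simp add: vec_eq_iff conj_transpose_def diag_def)

definition unidiag :: "complex^'n^'n \<Rightarrow> complex^'n \<Rightarrow> complex^'n^'n" where
  "unidiag U x = U ** diag x ** conj_transpose U"

lemma unidiag_mult:
  assumes "unitary U"
  shows "unidiag U x ** unidiag U y = unidiag U (\<chi> i. x $ i * y $ i)"
proof -
  have "unidiag U x ** unidiag U y = U ** diag x ** (conj_transpose U ** U) ** diag y ** conj_transpose U"
    by (simp add: unidiag_def matrix_mul_assoc)
  also have "\<dots> = U ** (diag x ** diag y) ** conj_transpose U"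
    using assms by (simp add: unitary_def matrix_mul_assoc)
  finally show ?thesis
    by (simp add: diag_mult unidiag_def)
qed

lemma unidiag_commute: "unitary U \<Longrightarrow> unidiag U x ** unidiag U y = unidiag U y ** unidiag U x"
  by (simp add: unidiag_mult mult.commute)

lemma conj_transpose_unidiag: "conj_transpose (unidiag U x) = unidiag U (\<chi> i. cnj (x $ i))"
  by (simp add: unidiag_def conj_transpose_mult conj_transpose_diag matrix_mul_assoc)

lemma normal_unidiag: "unitary U \<Longrightarrow> normal_matrix (unidiag U x)"
  by (simp add: normal_matrix_def conj_transpose_unidiag unidiag_commute)

lemma unidiag_column: "unitary U \<Longrightarrow> unidiag U x *v column j U = x $ j *s column j U"
proof -
  assume "unitary U"
  then have "unidiag U x ** U = U ** diag x"
    by (metis unidiag_def matrix_mul_assoc matrix_mul_rid unitary_def)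
  then show ?thesis
    by (metis matrix_mult_column column_mult_diag)
qed

lemma unidiag_eqI:
  assumes "unitary U" "\<And>j. A *v column j U = x $ j *s column j U"
  shows "A = unidiag U x"
  by (rule matrix_eq_on_columns[of U]) (simp_all add: assms unitary_invertible unidiag_column)

lemma spectral_theorem:
  assumes "normal_matrix A"
  obtains U x where "unitary U" "A = unidiag U x"
proof -
  obtain U where U: "unitary U" "\<And>i. \<exists>c. A *v column i U = c *s column i U"
    using normal_orthonormal_eigenbasis[OF assms, of "{}"] by auto
  then obtain c where "\<And>i. A *v column i U = c i *s column i U"
    by metis
  then have "A = unidiag U (\<chi> i. c i)"
    using U by (intro unidiag_eqI) auto
  then show thesis
    using that U by blast
qed

lemma orthonormal_extend:
  fixes f :: "'n::finite \<Rightarrow> complex^'n"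
  assumes "\<And>i j. i \<in> I \<Longrightarrow> j \<in> I \<Longrightarrow> cinner (f i) (f j) = (if i = j then 1 else 0)"
  obtains U where "unitary U" "\<And>i. i \<in> I \<Longrightarrow> column i U = f i"
proof -
  have "normal_matrix (mat 1 :: complex^'n^'n)"
    by (simp add: normal_matrix_def)
  moreover have "\<exists>c. mat 1 *v f i = c *s f i" for i
    by (metis matrix_vector_mul_lid vector_smult_lid)
  ultimately show thesis
    using normal_orthonormal_eigenbasis[of "mat 1" I f] assms that by metis
qed

lemma spectrum_unidiag:
  assumes "unitary U"
  shows "spectrum (unidiag U x) = range (($) x)"
proof safe
  fix c assume "c \<in> spectrum (unidiag U x)"
  then obtain v where v: "v \<noteq> 0" "unidiag U x *v v = c *s v"
    by (auto simp: spectrum_def)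
  define w where "w = conj_transpose U *v v"
  have Uw: "U *v w = v"
    by (simp add: w_def matrix_vector_mul_assoc unitary_right assms)
  have "conj_transpose U *v (unidiag U x *v v) = diag x *v w"
    using assms unfolding unidiag_def w_def unitary_def
    by (simp add: matrix_vector_mul_assoc matrix_mul_assoc)
  then have "diag x *v w = c *s w"
    by (simp add: v(2) w_def matrix_vector_mult_scale)
  moreover obtain i where "w $ i \<noteq> 0"
    using v(1) Uw by (metis matrix_vector_mult_0_right vec_eq_iff zero_index)
  ultimately show "c \<in> range (($) x)"
    by (auto simp: diag_vec vec_eq_iff)
next
  fix i
  have "column i U \<noteq> 0"
    using assms by (metis cinner_zero(1) unitary_columns zero_neq_one)
  then show "x $ i \<in> spectrum (unidiag U x)"
    using unidiag_column[OF assms] by (auto simp: spectrum_def)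
qed

lemma unidiag_normal_matrices:
  "unitary U \<Longrightarrow> unidiag U x \<in> normal_matrices X \<longleftrightarrow> x \<in> power_space X"
  by (auto simp: normal_matrices_def normal_unidiag spectrum_unidiag power_space_def)

lemma normal_matricesE:
  assumes "A \<in> normal_matrices X"
  obtains U x where "unitary U" "x \<in> power_space X" "A = unidiag U x"
  using assms spectral_theorem[of A] unidiag_normal_matrices
  by (metis (no_types, lifting) mem_Collect_eq normal_matrices_def)

section \<open>Continuity of diagonalizations and connectedness of the unitary group\<close>

lemma continuous_on_conj_transpose [continuous_intros]:
  fixes F :: "'t::topological_space \<Rightarrow> complex^'n^'n"
  assumes "continuous_on S F"
  shows "continuous_on S (\<lambda>t. conj_transpose (F t))"
  unfolding conj_transpose_def by (intro continuous_intros assms)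

lemma continuous_on_diag [continuous_intros]:
  fixes f :: "'t::topological_space \<Rightarrow> complex^'n"
  assumes "continuous_on S f"
  shows "continuous_on S (\<lambda>t. diag (f t))"
  unfolding diag_def
proof (intro continuous_intros)
  show "continuous_on S (\<lambda>t. if i = j then f t $ i else 0)" for i j :: 'n
    using assms by (cases "i = j") (auto intro: continuous_intros)
qed

lemma continuous_on_unidiag [continuous_intros]:
  fixes F :: "'t::topological_space \<Rightarrow> complex^'n^'n"
  assumes "continuous_on S F" "continuous_on S f"
  shows "continuous_on S (\<lambda>t. unidiag (F t) (f t))"
  unfolding unidiag_def by (intro continuous_intros assms)

text \<open>A unitary matrix is normal with eigenvalues exp(i \<theta>_k) in some unitary basis
  \<open>V\<close>; scaling the angles by t from 0 to 1 gives a path of unitary matrices from 1 to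
  it.\<close>

lemma connected_unitary: "connected {U :: complex^'n^'n. unitary U}"
proof -
  have "\<exists>S. connected S \<and> mat 1 \<in> S \<and> U \<in> S \<and> S \<subseteq> {U. unitary U}" if U: "unitary U" for U :: "complex^'n^'n"
  proof -
    have "normal_matrix U"
      using U by (simp add: normal_matrix_def unitary_right unitary_def[symmetric]) (simp add: unitary_def)
    then obtain V x where V: "unitary V" "U = unidiag V x"
      using spectral_theorem by blast
    have "norm (x $ i) = 1" for i
    proof -
      have "cinner (column i V) (conj_transpose U *v (U *v column i V)) = cinner (U *v column i V) (U *v column i V)"
        by (simp add: cinner_adjoint[of _ "conj_transpose U"])
      then have "cinner (column i V) (column i V) = x $ i * cnj (x $ i) * cinner (column i V) (column i V)"
        using U unfolding unitary_def matrix_vector_mul_assoc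
        by (simp add: V unidiag_column cinner_scale_left cinner_scale_right)
      then have "x $ i * cnj (x $ i) = 1"
        using V(1)[unfolded unitary_columns, rule_format, of i i] by simp
      then show ?thesis
        by (simp add: abs_square_eq_1 flip: complex_norm_square of_real_power)
    qed
    then have "\<exists>\<theta>::real. x $ i = exp (\<i> * \<theta>)" for i
      by (metis cis_conv_exp complex_norm_eq_1_exp)
    then obtain \<theta> :: "'n \<Rightarrow> real" where \<theta>: "\<And>i. x $ i = exp (\<i> * \<theta> i)"
      by metis
    define \<gamma> where "\<gamma> t = unidiag V (\<chi> i. exp (\<i> * of_real (t * \<theta> i)))" for t :: real
    have "continuous_on {0..1} \<gamma>"
      unfolding \<gamma>_def by (intro continuous_intros)
    then have "connected (\<gamma> ` {0..1})"
      by (intro connected_continuous_image) auto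
    moreover have "\<gamma> 0 = mat 1"
      unfolding \<gamma>_def using V(1) by (intro unidiag_eqI[symmetric]) auto
    moreover have "\<gamma> 1 = U"
      by (simp add: \<gamma>_def V(2) vec_eq_iff \<theta>[symmetric] cong: arg_cong[where f="unidiag V"])
    moreover have "unitary (\<gamma> t)" for t
    proof -
      have "cnj (exp (\<i> * of_real (t * \<theta> i))) * exp (\<i> * of_real (t * \<theta> i)) = 1" for i
        by (simp add: exp_cnj flip: exp_add)
      then have "conj_transpose (\<gamma> t) ** \<gamma> t = unidiag V (\<chi> i. 1)"
        using V(1) unfolding \<gamma>_def conj_transpose_unidiag by (simp add: unidiag_mult)
      also have "\<dots> = mat 1"
        using V(1) by (intro unidiag_eqI[symmetric]) auto
      finally show ?thesis
        by (simp add: unitary_def)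
    qed
    ultimately show ?thesis
      by (intro exI[of _ "\<gamma> ` {0..1}"]) (force simp: image_iff)
  qed
  then obtain S where S: "\<And>U::complex^'n^'n. unitary U \<Longrightarrow> connected (S U) \<and> mat 1 \<in> S U \<and> U \<in> S U \<and> S U \<subseteq> {U. unitary U}"
    by metis
  have "connected (\<Union>(S ` {U. unitary U}))"
    using S by (intro connected_Union) auto
  moreover have "\<Union>(S ` {U. unitary U}) = {U. unitary U}"
    using S by blast
  ultimately show ?thesis
    by simp
qed

subsection \<open>Permutations and configuration spaces\<close>

lemma permutes_UNIV_iff: "p permutes UNIV \<longleftrightarrow> bij p"
  by (metis UNIV_I bij_imp_permutes permutes_bij)

text \<open>Evaluated at a matrix with the distinct eigenvalues \<open>x\<close>, this is the
  idempotent onto the i-th eigenline along the other ones.\<close>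

definition lagrange :: "complex^'n \<Rightarrow> 'n \<Rightarrow> complex poly" where
  "lagrange x i = (\<Prod>j\<in>UNIV - {i}. smult (1 / (x $ i - x $ j)) [:- x $ j, 1:])"

lemma poly_lagrange:
  assumes "inj (($) x)"
  shows "poly (lagrange x i) (x $ j) = (if i = j then 1 else 0)"
proof (cases "i = j")
  case True
  have "x $ i \<noteq> x $ k" if "k \<noteq> i" for k
    using assms that by (auto dest: injD)
  then show ?thesis
    using True by (auto simp: lagrange_def poly_prod algebra_simps diff_divide_distrib[symmetric] intro!: prod.neutral)
next
  case False
  then show ?thesis
    unfolding lagrange_def poly_prod
    by (auto simp: intro!: prod_zero bexI[of _ j])
qed

section \<open>Eigenbases of matrices with distinct eigenvalues\<close>

lemma invertible_expand:
  fixes V :: "complex^'n^'n"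
  assumes "invertible V"
  obtains d where "w = (\<Sum>j\<in>UNIV. d $ j *s column j V)"
proof -
  have "w = V *v (matrix_inv V *v w)"
    by (simp add: matrix_vector_mul_assoc invertible_matrix_inv assms)
  also have "\<dots> = (\<Sum>j\<in>UNIV. (matrix_inv V *v w) $ j *s column j V)"
    by (rule matrix_mult_sum)
  finally show thesis
    using that by blast
qed

lemma column_invertible_nonzero: "column j V \<noteq> 0" if "invertible V" for V :: "complex^'n^'n"
  using that unfolding invertible_iff_trivial_kernel matrix_vector_mult_axis[symmetric]
  by (metis axis_eq_0_iff one_neq_zero)

lemma columns_independent:
  fixes V :: "complex^'n^'n"
  assumes "invertible V" "(\<Sum>j\<in>UNIV. d j *s column j V) = 0"
  shows "d k = 0"
proof -
  have "V *v (\<chi> j. d j) = 0"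
    unfolding matrix_mult_sum[of V] using assms(2) by simp
  then have "(\<chi> j. d j) = 0"
    using assms(1) invertible_iff_trivial_kernel by blast
  then show ?thesis
    by (simp add: vec_eq_iff)
qed

text \<open>Applying the i-th Lagrange polynomial of M to a linear relation among eigenvectors
  leaves only its i-th term, so eigenvectors for distinct eigenvalues are independent.\<close>

lemma eigenbasis_of_distinct_spectrum:
  fixes M :: "complex^'n^'n" and x :: "complex^'n"
  assumes inj: "inj (($) x)" and spec: "\<And>i. x $ i \<in> spectrum M"
  obtains V where "invertible V" "\<And>j. M *v column j V = x $ j *s column j V"
proof -
  obtain v where v: "\<And>i. v i \<noteq> 0" "\<And>i. M *v v i = x $ i *s v i"
    using spec unfolding spectrum_def by simp metis
  define V where "V = (\<chi> r c. v c $ r)"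
  have col: "column j V = v j" for j
    by (simp add: V_def column_def vec_eq_iff)
  have "c = 0" if "V *v c = 0" for c
  proof -
    have 0: "(\<Sum>j\<in>UNIV. c $ j *s v j) = 0"
      using that matrix_mult_sum[of V c] by (simp add: col)
    have "c $ i = 0" for i
    proof -
      have "(\<Sum>j\<in>UNIV. c $ j *s (matpoly (lagrange x i) M *v v j)) = matpoly (lagrange x i) M *v 0"
        unfolding 0[symmetric] by (simp add: matrix_vector_mult_sum_right matrix_vector_mult_scale)
      then have "(\<Sum>j\<in>UNIV. (if i = j then c $ j else 0) *s v j) = 0"
        by (simp add: matpoly_eigenvector[OF v(2)] poly_lagrange[OF inj] vector_smult_assoc
            if_distrib[of "\<lambda>x. _ * x"] cong: if_cong)
      then have "c $ i *s v i = 0"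
        by (simp add: if_distrib[of "\<lambda>x. x *s _"] cong: if_cong)
      then show ?thesis
        using v(1) by simp
    qed
    then show ?thesis
      by (simp add: vec_eq_iff)
  qed
  then have "invertible V"
    by (intro invertible_iff_trivial_kernel[THEN iffD2] allI impI)
  then show thesis
    using that v(2) by (simp add: col)
qed

text \<open>N maps each eigenspace of M to itself, and these are lines, so N is diagonal in the same
  basis. An eigenvector of N for \<open>y $ i\<close> has a nonzero coordinate, and the diagonal
  entry there must be \<open>y $ i\<close>; as the \<open>y $ i\<close> are distinct, the positions
  so found form a bijection.\<close>

lemma commuting_eigenbasis:
  fixes M N V :: "complex^'n^'n" and x y :: "complex^'n"
  assumes V: "invertible V" and M: "\<And>j. M *v column j V = x $ j *s column j V" and x: "inj (($) x)"
    and comm: "M ** N = N ** M" and y: "inj (($) y)" "\<And>i. y $ i \<in> spectrum N"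
  obtains \<tau> where "bij \<tau>" "\<And>i. N *v column (\<tau> i) V = y $ i *s column (\<tau> i) V"
proof -
  have "\<exists>c. N *v column j V = c *s column j V" for j
  proof -
    define w where "w = N *v column j V"
    have "M *v w = x $ j *s w"
      by (metis M comm matrix_vector_mul_assoc matrix_vector_mult_scale w_def)
    then have 1: "matpoly (lagrange x j) M *v w = w"
      using matpoly_eigenvector[of M w "x $ j"] by (simp add: poly_lagrange x)
    obtain d where "w = (\<Sum>k\<in>UNIV. d $ k *s column k V)"
      using invertible_expand[OF V] by metis
    then have "matpoly (lagrange x j) M *v w = (\<Sum>k\<in>UNIV. d $ k *s (if j = k then column k V else 0))"
      by (simp add: matrix_vector_mult_sum_right matrix_vector_mult_scale matpoly_eigenvector[OF M]
          poly_lagrange x if_distrib[of "\<lambda>x. x *s _"] cong: if_cong)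
    also have "\<dots> = d $ j *s column j V"
      by (simp add: if_distrib[of "\<lambda>x. _ *s x"] cong: if_cong)
    finally show ?thesis
      using 1 w_def by metis
  qed
  then obtain c where c: "\<And>j. N *v column j V = c j *s column j V"
    by metis
  have "\<exists>k. c k = y $ i" for i
  proof -
    obtain w where w: "w \<noteq> 0" "N *v w = y $ i *s w"
      using y(2)[of i] by (auto simp: spectrum_def)
    obtain d where d: "w = (\<Sum>k\<in>UNIV. d $ k *s column k V)"
      using invertible_expand[OF V] by metis
    have "N *v w - y $ i *s w = (\<Sum>k\<in>UNIV. (d $ k * (c k - y $ i)) *s column k V)"
      unfolding d matrix_vector_mult_sum_right vec.scale_sum_right sum_subtractf[symmetric]
      by (intro sum.cong) (simp_all add: matrix_vector_mult_scale c vec_eq_iff algebra_simps)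
    then have "(\<Sum>k\<in>UNIV. (d $ k * (c k - y $ i)) *s column k V) = 0"
      using w(2) by simp
    then have "d $ k * (c k - y $ i) = 0" for k
      by (rule columns_independent[OF V])
    moreover have "\<exists>k. d $ k \<noteq> 0"
      using w(1) d by (metis (no_types, lifting) sum.neutral vector_smult_lzero)
    ultimately show ?thesis
      by (metis eq_iff_diff_eq_0 mult_eq_0_iff)
  qed
  then obtain \<tau> where \<tau>: "\<And>i. c (\<tau> i) = y $ i"
    by metis
  then have "inj \<tau>"
    using y(1) by (metis injI injD)
  then have "bij \<tau>"
    using finite_UNIV_inj_surj[of \<tau>] by (simp add: bij_def)
  then show thesis
    using that c \<tau> by metis
qed

text \<open>All transpositions are conjugate, so if one of them went to the identity, \<rho> would
  be trivial; hence \<rho> fixes the transposition of every edge. Being fixed passes from (a b) and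
  (b c) to (a c) = (a b)(b c)(a b), and the cycle visits every vertex, so all transpositions are
  fixed.\<close>

lemma perm_endomorphism_trivial:
  fixes \<rho> :: "('v \<Rightarrow> 'v) \<Rightarrow> ('v::finite \<Rightarrow> 'v)"
  assumes bij: "\<And>\<theta>. bij \<theta> \<Longrightarrow> bij (\<rho> \<theta>)"
    and hom: "\<And>\<theta> \<eta>. bij \<theta> \<Longrightarrow> bij \<eta> \<Longrightarrow> \<rho> (\<theta> \<circ> \<eta>) = \<rho> \<theta> \<circ> \<rho> \<eta>"
    and cycle: "contains_cycle CARD('v) E"
    and edge: "\<And>i j. i \<noteq> j \<Longrightarrow> {i, j} \<in> E \<Longrightarrow>
      \<rho> (Transposition.transpose i j) = Transposition.transpose i j \<or> \<rho> (Transposition.transpose i j) = id"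
    and nontrivial: "bij \<theta>0" "\<rho> \<theta>0 \<noteq> id"
    and "bij \<theta>"
  shows "\<rho> \<theta> = \<theta>"
proof -
  have \<rho>id: "\<rho> id = id"
  proof -
    have "\<rho> id \<circ> \<rho> id = \<rho> id"
      using hom[of id id] by simp
    then show ?thesis
      using bij[of id] by (metis bij_id bij_is_inj fun.map_id inj_iff comp_assoc id_comp)
  qed
  \<comment> \<open>Transpositions generate, so agreement on them suffices. This is used twice: with
    \<open>F\<close> constantly \<open>id\<close> for the contradiction, and with the identity map
    for the conclusion.\<close>
  have gen: "\<rho> \<theta> = F \<theta>" if "bij \<theta>" "F id = id" "\<And>a b p. bij p \<Longrightarrow> F (Transposition.transpose a b \<circ> p) = F (Transposition.transpose a b) \<circ> F p"
    and "\<And>a b. a \<noteq> b \<Longrightarrow> \<rho> (Transposition.transpose a b) = F (Transposition.transpose a b)" for F \<theta>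
    using that(1)[folded permutes_UNIV_iff] finite_class.finite_UNIV
  proof (induction rule: permutes_induct)
    case id
    show ?case
      unfolding \<rho>id that(2) ..
  next
    case (swap a b p)
    then have "\<rho> (Transposition.transpose a b \<circ> p) = \<rho> (Transposition.transpose a b) \<circ> \<rho> p"
      by (intro hom) (simp_all add: permutes_UNIV_iff)
    also have "\<dots> = F (Transposition.transpose a b) \<circ> F p"
      using swap that(4) by simp
    also have "\<dots> = F (Transposition.transpose a b \<circ> p)"
      using swap that(3) by (simp add: permutes_UNIV_iff)
    finally show ?case .
  qed
  have no_id: "\<rho> (Transposition.transpose i j) \<noteq> id" if ij: "i \<noteq> j" for i j
  proof
    assume 0: "\<rho> (Transposition.transpose i j) = id"
    have "\<rho> (Transposition.transpose a b) = id" if "a \<noteq> b" for a b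
    proof -
      \<comment> \<open>A permutation with i \<mapsto> a and j \<mapsto> b: first i is moved to a,
        then the current place of j is moved to b, which leaves a alone.\<close>
      define \<pi> where "\<pi> = Transposition.transpose (Transposition.transpose i a j) b \<circ> Transposition.transpose i a"
      have b\<pi>: "bij \<pi>"
        unfolding \<pi>_def by (intro bij_comp) auto
      have "\<pi> i = a"
        using ij that by (auto simp: \<pi>_def Transposition.transpose_def)
      moreover have "\<pi> j = b"
        by (simp add: \<pi>_def)
      ultimately have "inv \<pi> a = i" "inv \<pi> b = j"
        using b\<pi> by (metis bij_is_inj inv_f_f)+
      then have eq: "Transposition.transpose a b \<circ> \<pi> = \<pi> \<circ> Transposition.transpose i j"
        using transpose_comp_eq[OF b\<pi>, of a b] by simp
      have "\<rho> (Transposition.transpose a b) \<circ> \<rho> \<pi> = \<rho> \<pi>"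
        using arg_cong[OF eq, of \<rho>] b\<pi> by (simp add: hom 0)
      then show ?thesis
        using bij[OF b\<pi>] by (metis bij_is_surj comp_assoc comp_id id_comp surj_iff)
    qed
    then have "\<rho> \<theta>0 = id"
      using gen[of \<theta>0 "\<lambda>_. id"] nontrivial by auto
    then show False
      using nontrivial by blast
  qed
  define R where "R a b \<longleftrightarrow> a = b \<or> \<rho> (Transposition.transpose a b) = Transposition.transpose a b" for a b
  have Rsym: "R b a" if "R a b" for a b
    using that by (auto simp: R_def transpose_commute)
  have Rtrans: "R a c" if ab: "R a b" and bc: "R b c" for a b c
  proof (cases "a = b \<or> b = c \<or> a = c")
    case False
    then have "Transposition.transpose a c = Transposition.transpose a b \<circ> Transposition.transpose b c \<circ> Transposition.transpose a b"
      using transpose_comp_triple[of a c b] by simp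
    then show ?thesis
      using ab bc False by (simp add: R_def hom bij_comp)
  qed (use ab bc in \<open>auto simp: R_def\<close>)
  obtain vs where vs: "length vs = CARD('v)" "distinct vs"
    "\<And>m. m < CARD('v) \<Longrightarrow> {vs ! m, vs ! (Suc m mod CARD('v))} \<in> E"
    using cycle by (auto simp: contains_cycle_def)
  have "set vs = UNIV"
    using vs(1,2) by (metis card_subset_eq distinct_card finite_class.finite_UNIV subset_UNIV)
  have R0: "R (vs ! 0) (vs ! m)" if "m < CARD('v)" for m
    using that
  proof (induction m)
    case (Suc m)
    have "{vs ! m, vs ! Suc m} \<in> E"
      using vs(3)[of m] Suc by simp
    moreover have "vs ! m \<noteq> vs ! Suc m"
      using vs(1,2) Suc by (simp add: nth_eq_iff_index_eq)
    ultimately have "R (vs ! m) (vs ! Suc m)"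
      using edge no_id by (auto simp: R_def)
    then show ?case
      using Rtrans Suc by simp
  qed (simp add: R_def)
  have "R (vs ! 0) a" for a
    using R0 \<open>set vs = UNIV\<close> vs(1) by (metis UNIV_I in_set_conv_nth)
  then have "R a b" for a b
    using Rsym Rtrans by blast
  then show ?thesis
    using gen[of \<theta> "\<lambda>\<theta>. \<theta>"] \<open>bij \<theta>\<close> by (auto simp: R_def)
qed

section \<open>Density of configurations and permutation of columns\<close>

lemma ex_inj_choice:
  assumes "finite I" "\<And>i. i \<in> I \<Longrightarrow> infinite (A i)"
  shows "\<exists>f. inj_on f I \<and> (\<forall>i\<in>I. f i \<in> A i)"
  using assms
proof (induction I)
  case (insert k I)
  then obtain f where f: "inj_on f I" "\<forall>i\<in>I. f i \<in> A i"
    by auto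
  have "infinite (A k - f ` I)"
    using insert by auto
  then obtain z where "z \<in> A k - f ` I"
    using infinite_imp_nonempty by blast
  then show ?case
    using f insert(2) by (intro exI[of _ "f(k := z)"]) (auto simp: inj_on_def)
qed auto

lemma config_space_iff: "x \<in> config_space X \<longleftrightarrow> x \<in> power_space X \<and> inj (($) x)"
  by (auto simp: config_space_def inj_on_def)

text \<open>Every coordinate of \<open>y\<close> is a limit point of X, so each small ball around it
  contains infinitely many points of X, enough to choose distinct ones for all indices.\<close>

lemma config_space_dense:
  assumes "perfect_set X" "y \<in> power_space X"
  shows "y \<in> top_of_set (power_space X) closure_of (config_space X :: (complex^'n) set)"
proof -
  have "\<exists>x\<in>config_space X. dist x y < \<epsilon>" if "\<epsilon> > 0" for \<epsilon>
  proof -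
    define \<delta> where "\<delta> = \<epsilon> / CARD('n)"
    have "\<delta> > 0"
      using that by (simp add: \<delta>_def)
    have "infinite (X \<inter> ball (y $ i) \<delta>)" for i
    proof -
      have yi: "y $ i \<in> X"
        using assms(2) by (simp add: power_space_def)
      then have "y $ i \<in> closure (X - {y $ i})"
        using assms(1) by (auto simp: perfect_set_def closure_of_subtopology closure_mono[THEN subsetD])
          (metis Diff_subset Int_absorb1)
      then have "y $ i islimpt X"
        by (simp add: islimpt_in_closure)
      then show ?thesis
        using \<open>\<delta> > 0\<close> by (simp add: islimpt_eq_infinite_ball)
    qed
    then obtain f where f: "inj f" "\<And>i. f i \<in> X \<inter> ball (y $ i) \<delta>"
      using ex_inj_choice[of "UNIV :: 'n set" "\<lambda>i. X \<inter> ball (y $ i) \<delta>"] by auto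
    define x where "x = (\<chi> i. f i)"
    have "x \<in> config_space X"
      using f by (auto simp: config_space_iff power_space_def x_def inj_on_def)
    moreover have "dist x y < \<epsilon>"
    proof -
      have "dist x y \<le> (\<Sum>i\<in>UNIV. dist (x $ i) (y $ i))"
        unfolding dist_vec_def by (rule L2_set_le_sum) simp
      also have "\<dots> < (\<Sum>i\<in>(UNIV :: 'n set). \<delta>)"
        using f(2) by (intro sum_strict_mono) (auto simp: x_def dist_commute)
      also have "\<dots> = \<epsilon>"
        by (simp add: \<delta>_def)
      finally show ?thesis .
    qed
    ultimately show ?thesis
      by blast
  qed
  then have "y \<in> closure (config_space X)"
    by (simp add: closure_approachable)
  moreover have "power_space X \<inter> config_space X = (config_space X :: (complex^'n) set)"
    by (auto simp: config_space_def)
  ultimately show ?thesis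
    using assms(2) by (simp add: closure_of_subtopology)
qed

definition permute_columns :: "complex^'n^'n \<Rightarrow> ('n \<Rightarrow> 'n) \<Rightarrow> complex^'n^'n" where
  "permute_columns U \<theta> = (\<chi> r c. U $ r $ \<theta> c)"

lemma column_permute_columns [simp]: "column c (permute_columns U \<theta>) = column (\<theta> c) U"
  by (simp add: permute_columns_def column_def)

lemma permute_columns_comp: "permute_columns U (\<theta> \<circ> \<eta>) = permute_columns (permute_columns U \<theta>) \<eta>"
  by (simp add: permute_columns_def vec_eq_iff)

lemma unitary_permute_columns: "unitary U \<Longrightarrow> bij \<theta> \<Longrightarrow> unitary (permute_columns U \<theta>)"
  by (auto simp: unitary_columns dest: bij_is_inj injD)

lemma unidiag_permute_columns:
  assumes "unitary U" "bij \<theta>"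
  shows "unidiag (permute_columns U \<theta>) (x \<triangleleft> \<theta>) = unidiag U x"
  using assms by (intro unidiag_eqI[symmetric] unitary_permute_columns)
    (simp_all add: unidiag_column perm_act_def)

lemma perm_act_config_space: "x \<in> config_space X \<Longrightarrow> bij \<theta> \<Longrightarrow> x \<triangleleft> \<theta> \<in> config_space X"
  unfolding config_space_iff power_space_def perm_act_def
  by (auto simp: inj_on_def bij_def)

section \<open>Permutations attached to a continuous CS preserver\<close>

locale cs_map =
  fixes X :: "complex set" and \<phi> :: "complex^'n^'n \<Rightarrow> complex^'n^'n" and x0 :: "complex^'n"
  assumes cont: "continuous_on (normal_matrices X) \<phi>"
    and CS: "CS_preserver (normal_matrices X) \<phi>"
    and x0: "x0 \<in> config_space X"
begin

definition B :: "complex^'n^'n \<Rightarrow> complex^'n^'n" where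
  "B U = \<phi> (unidiag U x0)"

text \<open>The idempotents onto the eigenlines of \<open>B U\<close>; the coordinates of
  \<open>x0\<close> label these lines by indices.\<close>

definition P :: "'n \<Rightarrow> complex^'n^'n \<Rightarrow> complex^'n^'n" where
  "P i U = matpoly (lagrange x0 i) (B U)"

text \<open>The eigenvalue \<open>x $ i\<close> is placed on the line with label
  \<open>\<tau> i\<close>: the permutation acts on labels of lines, not on coordinates.\<close>

definition S :: "('n \<Rightarrow> 'n) \<Rightarrow> complex^'n \<Rightarrow> complex^'n^'n \<Rightarrow> complex^'n^'n" where
  "S \<tau> x U = (\<Sum>i\<in>UNIV. mat (x $ i) ** P (\<tau> i) U)"

lemma spectrum_\<phi>: "x \<in> power_space X \<Longrightarrow> unitary U \<Longrightarrow> spectrum (\<phi> (unidiag U x)) = range (($) x)"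
  using CS by (simp add: CS_preserver_def unidiag_normal_matrices spectrum_unidiag)

lemma inj_x0: "inj (($) x0)" and x0_power: "x0 \<in> power_space X"
  using x0 by (auto simp: config_space_iff)

lemma config_power: "x \<in> config_space X \<Longrightarrow> x \<in> power_space X"
  and config_inj: "x \<in> config_space X \<Longrightarrow> inj (($) x)"
  by (auto simp: config_space_iff)

lemma eigenbasis_B:
  assumes "unitary U"
  obtains V where "invertible V" "\<And>j. B U *v column j V = x0 $ j *s column j V"
    "\<And>i j. P i U *v column j V = (if i = j then column j V else 0)"
proof -
  have "\<And>i. x0 $ i \<in> spectrum (B U)"
    using spectrum_\<phi>[OF x0_power assms] by (simp add: B_def)
  then obtain V where V: "invertible V" "\<And>j. B U *v column j V = x0 $ j *s column j V"
    using eigenbasis_of_distinct_spectrum[OF inj_x0] by metis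
  then have "P i U *v column j V = (if i = j then column j V else 0)" for i j
    unfolding P_def matpoly_eigenvector[OF V(2)] by (simp add: poly_lagrange inj_x0)
  then show thesis
    using that V by blast
qed

lemma S_column:
  assumes P: "\<And>i j. P i U *v column j V = (if i = j then column j V else 0)" and "bij \<tau>"
  shows "S \<tau> x U *v column (\<tau> j) V = x $ j *s column (\<tau> j) V"
proof -
  have "S \<tau> x U *v column (\<tau> j) V = (\<Sum>i\<in>UNIV. x $ i *s (P (\<tau> i) U *v column (\<tau> j) V))"
    by (simp add: S_def matrix_vector_mult_sum_left flip: matrix_vector_mul_assoc)
  also have "\<dots> = (\<Sum>i\<in>UNIV. if i = j then x $ j *s column (\<tau> j) V else 0)"
    using \<open>bij \<tau>\<close> by (intro sum.cong) (auto simp: P dest: bij_is_inj injD)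
  finally show ?thesis
    by simp
qed

text \<open>The matrices for \<open>x\<close> and \<open>x0\<close> are diagonal in the columns of
  the same U, hence commute, and so do their images. As \<open>B U\<close> has simple spectrum, its
  eigenbasis also diagonalizes the other image, and preservation of spectra tells which eigenvalues
  occur.\<close>

lemma \<phi>_eq_S:
  assumes "x \<in> config_space X" "unitary U"
  obtains \<tau> where "bij \<tau>" "\<phi> (unidiag U x) = S \<tau> x U"
proof -
  obtain V where V: "invertible V" "\<And>j. B U *v column j V = x0 $ j *s column j V"
    "\<And>i j. P i U *v column j V = (if i = j then column j V else 0)"
    using eigenbasis_B[OF assms(2)] by metis
  have "unidiag U x0 \<in> normal_matrices X" "unidiag U x \<in> normal_matrices X"
    using x0_power config_power[OF assms(1)] assms(2) by (simp_all add: unidiag_normal_matrices)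
  then have "B U ** \<phi> (unidiag U x) = \<phi> (unidiag U x) ** B U"
    using CS unidiag_commute[OF assms(2)] unfolding CS_preserver_def B_def by blast
  moreover have "\<And>i. x $ i \<in> spectrum (\<phi> (unidiag U x))"
    using spectrum_\<phi>[OF config_power] assms by simp
  ultimately obtain \<tau> where \<tau>: "bij \<tau>" "\<And>i. \<phi> (unidiag U x) *v column (\<tau> i) V = x $ i *s column (\<tau> i) V"
    using commuting_eigenbasis[OF V(1,2) inj_x0 _ config_inj[OF assms(1)]] by metis
  have "\<phi> (unidiag U x) *v column j V = S \<tau> x U *v column j V" for j
  proof -
    obtain i where "j = \<tau> i"
      using \<tau>(1) by (metis bij_pointE)
    then show ?thesis
      using \<tau> S_column[OF V(3) \<tau>(1)] by simp
  qed
  then have "\<phi> (unidiag U x) = S \<tau> x U"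
    using matrix_eq_on_columns[OF V(1)] by blast
  then show thesis
    using that \<tau>(1) by blast
qed

lemma S_eqD:
  assumes "unitary U" "bij \<tau>" "bij \<tau>'" "S \<tau> x U = S \<tau>' y U" "\<tau> i = \<tau>' j"
  shows "x $ i = y $ j"
proof -
  obtain V where V: "invertible V" "\<And>j. B U *v column j V = x0 $ j *s column j V"
    "\<And>i j. P i U *v column j V = (if i = j then column j V else 0)"
    using eigenbasis_B[OF assms(1)] by metis
  have "x $ i *s column (\<tau> i) V = y $ j *s column (\<tau> i) V"
    using S_column[OF V(3) assms(2), of x i] S_column[OF V(3) assms(3), of y j] assms(4,5) by metis
  then show ?thesis
    using column_invertible_nonzero[OF V(1), of "\<tau> i"] by (metis vector_mul_rcancel)
qed

lemma S_inj:
  assumes "unitary U" "bij \<tau>" "bij \<tau>'" "S \<tau> x U = S \<tau>' x U" "inj (($) x)"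
  shows "\<tau> = \<tau>'"
proof
  fix i
  obtain j where j: "\<tau> i = \<tau>' j"
    using assms(3) by (metis bij_pointE)
  then have "x $ i = x $ j"
    using S_eqD[OF assms(1-4)] by blast
  then show "\<tau> i = \<tau>' i"
    using assms(5) j by (auto dest: injD)
qed

text \<open>Allows the idempotents to be recovered from the value at any configuration
  \<open>y\<close>, not only at the base point.\<close>

lemma matpoly_S:
  assumes "unitary U" "bij \<tau>" "\<And>j. poly p (y $ j) = (if k = j then 1 else 0)"
  shows "matpoly p (S \<tau> y U) = P (\<tau> k) U"
proof -
  obtain V where V: "invertible V" "\<And>j. B U *v column j V = x0 $ j *s column j V"
    "\<And>i j. P i U *v column j V = (if i = j then column j V else 0)"
    using eigenbasis_B[OF assms(1)] by metis
  have "matpoly p (S \<tau> y U) *v column j V = P (\<tau> k) U *v column j V" for j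
  proof -
    obtain i where i: "j = \<tau> i"
      using assms(2) by (metis bij_pointE)
    then show ?thesis
      using matpoly_eigenvector[OF S_column[OF V(3) assms(2)]] assms(2,3)
      by (auto simp: V(3) dest: bij_is_inj injD)
  qed
  then show ?thesis
    using matrix_eq_on_columns[OF V(1)] by blast
qed

lemma P_inj:
  assumes "unitary U" "P i U = P j U"
  shows "i = j"
proof -
  obtain V where V: "invertible V" "\<And>i j. P i U *v column j V = (if i = j then column j V else 0)"
    using eigenbasis_B[OF assms(1)] by metis
  then have "P j U *v column i V = column i V"
    using assms(2) by metis
  then show ?thesis
    using V(2)[of j i] column_invertible_nonzero[OF V(1), of i] by (auto split: if_splits)
qed

lemma continuous_on_\<phi>:
  assumes "continuous_on Z u" "continuous_on Z f" "\<And>z. z \<in> Z \<Longrightarrow> unitary (u z) \<and> f z \<in> power_space X"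
  shows "continuous_on Z (\<lambda>z. \<phi> (unidiag (u z) (f z)))"
  by (rule continuous_on_compose2[OF cont])
    (use assms in \<open>auto intro!: continuous_intros simp: unidiag_normal_matrices\<close>)

lemma continuous_on_P:
  assumes "continuous_on Z u" "\<And>z. z \<in> Z \<Longrightarrow> unitary (u z)"
  shows "continuous_on Z (\<lambda>z. P i (u z))"
  unfolding P_def B_def
  by (intro continuous_intros continuous_on_\<phi>) (use assms x0_power in auto)

lemma continuous_on_S:
  assumes "continuous_on Z u" "continuous_on Z f" "\<And>z. z \<in> Z \<Longrightarrow> unitary (u z)"
  shows "continuous_on Z (\<lambda>z. S \<tau> (f z) (u z))"
  unfolding S_def
  by (intro continuous_intros continuous_on_P assms)

text \<open>On the connected space of pairs (x, U), the set where the formula holds for a given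
  \<tau> is closed. These sets are finitely many, cover the space, and are disjoint because the
  coordinates of a configuration are distinct, so one of them is everything. Working on the product
  removes the dependence on x and on U together.\<close>

lemma \<phi>_eq_S_connected:
  assumes D: "connected D" "D \<subseteq> config_space X" "D \<noteq> {}"
  obtains \<tau> where "bij \<tau>" "\<And>x U. x \<in> D \<Longrightarrow> unitary U \<Longrightarrow> \<phi> (unidiag U x) = S \<tau> x U"
proof -
  define Z where "Z = D \<times> {U :: complex^'n^'n. unitary U}"
  define K where "K \<tau> = {z \<in> Z. \<phi> (unidiag (snd z) (fst z)) - S \<tau> (fst z) (snd z) = 0}" for \<tau>
  have "connected Z"
    unfolding Z_def by (intro connected_Times connected_unitary D)
  have "closedin (top_of_set Z) (K \<tau>)" for \<tau>
    unfolding K_def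
    by (intro continuous_closedin_preimage_constant continuous_on_diff continuous_on_S continuous_on_\<phi> continuous_intros)
      (use D in \<open>auto simp: Z_def config_space_iff\<close>)
  moreover have "finite {\<tau> :: 'n \<Rightarrow> 'n. bij \<tau>}"
    using finite_permutations[of "UNIV :: 'n set"] by (simp add: permutes_UNIV_iff)
  ultimately have closed: "closedin (top_of_set Z) (K \<tau>)" "closedin (top_of_set Z) (\<Union>(K ` ({\<tau>. bij \<tau>} - {\<tau>})))" for \<tau>
    by (auto intro!: closedin_Union)
  have cover: "\<exists>\<tau>. bij \<tau> \<and> z \<in> K \<tau>" if "z \<in> Z" for z
  proof -
    have "fst z \<in> config_space X" "unitary (snd z)"
      using that D(2) by (auto simp: Z_def)
    then obtain \<tau> where "bij \<tau>" "\<phi> (unidiag (snd z) (fst z)) = S \<tau> (fst z) (snd z)"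
      using \<phi>_eq_S by metis
    then show ?thesis
      using that by (auto simp: K_def)
  qed
  have disj: "\<tau> = \<tau>'" if "z \<in> K \<tau>" "z \<in> K \<tau>'" "bij \<tau>" "bij \<tau>'" for z \<tau> \<tau>'
    using S_inj[of "snd z" \<tau> \<tau>' "fst z"] that D(2) by (auto simp: K_def Z_def config_space_iff)
  obtain x where "x \<in> D"
    using D(3) by blast
  then have z0: "(x, mat 1) \<in> Z"
    by (simp add: Z_def)
  then obtain \<tau> where \<tau>: "bij \<tau>" "(x, mat 1) \<in> K \<tau>"
    using cover by blast
  have "K \<tau> \<inter> \<Union>(K ` ({\<tau>. bij \<tau>} - {\<tau>})) = {}"
    using disj \<tau>(1) by blast
  moreover have "Z \<subseteq> K \<tau> \<union> \<Union>(K ` ({\<tau>. bij \<tau>} - {\<tau>}))"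
    using cover by blast
  ultimately have "\<Union>(K ` ({\<tau>. bij \<tau>} - {\<tau>})) = {}"
    using \<open>connected Z\<close> closed[of \<tau>] \<tau>(2) unfolding connected_closedin by blast
  then have "Z \<subseteq> K \<tau>"
    using cover by blast
  then have "\<phi> (unidiag U x) = S \<tau> x U" if "x \<in> D" "unitary U" for x U
    using that by (force simp: Z_def K_def)
  then show thesis
    using that \<tau>(1) by blast
qed

text \<open>One permutation serving all unitaries at once; it exists by the preceding lemma for a
  single configuration and is determined by any one unitary.\<close>

definition tau :: "complex^'n \<Rightarrow> 'n \<Rightarrow> 'n" where
  "tau x = (SOME \<tau>. bij \<tau> \<and> (\<forall>U. unitary U \<longrightarrow> \<phi> (unidiag U x) = S \<tau> x U))"

lemma
  assumes "x \<in> config_space X"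
  shows bij_tau: "bij (tau x)" and \<phi>_tau: "unitary U \<Longrightarrow> \<phi> (unidiag U x) = S (tau x) x U"
proof -
  obtain \<tau> where "bij \<tau>" "\<And>x' U. x' \<in> {x} \<Longrightarrow> unitary U \<Longrightarrow> \<phi> (unidiag U x') = S \<tau> x' U"
    using \<phi>_eq_S_connected[of "{x}"] assms by auto
  then have "\<exists>\<tau>. bij \<tau> \<and> (\<forall>U. unitary U \<longrightarrow> \<phi> (unidiag U x) = S \<tau> x U)"
    by blast
  then have "bij (tau x) \<and> (\<forall>U. unitary U \<longrightarrow> \<phi> (unidiag U x) = S (tau x) x U)"
    unfolding tau_def by (rule someI_ex)
  then show "bij (tau x)" "unitary U \<Longrightarrow> \<phi> (unidiag U x) = S (tau x) x U"
    by blast+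
qed

lemma tau_unique:
  assumes "x \<in> config_space X" "unitary U" "bij \<tau>" "\<phi> (unidiag U x) = S \<tau> x U"
  shows "tau x = \<tau>"
  using S_inj[OF assms(2) bij_tau[OF assms(1)] assms(3)] \<phi>_tau assms config_inj by metis

lemma tau_connected:
  assumes "connected D" "D \<subseteq> config_space X" "x \<in> D" "y \<in> D"
  shows "tau x = tau y"
proof -
  obtain \<tau> where "bij \<tau>" "\<And>x U. x \<in> D \<Longrightarrow> unitary U \<Longrightarrow> \<phi> (unidiag U x) = S \<tau> x U"
    using \<phi>_eq_S_connected[OF assms(1,2)] assms(3) by blast
  then have "tau z = \<tau>" if "z \<in> D" for z
    using tau_unique[of z "mat 1"] that assms(2) by auto
  then show ?thesis
    using assms by metis
qed

lemma tau_x0: "tau x0 = id"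
proof -
  obtain V where V: "invertible V" "\<And>j. B (mat 1) *v column j V = x0 $ j *s column j V"
    "\<And>i j. P i (mat 1) *v column j V = (if i = j then column j V else 0)"
    using eigenbasis_B[OF unitary_mat_1] by metis
  have "B (mat 1) = S id x0 (mat 1)"
    using S_column[OF V(3) bij_id, of x0] V(2) by (intro matrix_eq_on_columns[OF V(1)]) simp
  then show ?thesis
    using tau_unique[OF x0 unitary_mat_1 bij_id] by (simp add: B_def)
qed

text \<open>The formula is forced by the law \<open>rho \<theta> \<circ> tau (x \<triangleleft>
  \<theta>) = tau x \<circ> \<theta>\<close> at \<open>x0\<close>, where \<open>tau\<close> is the
  identity.\<close>

definition rho :: "('n \<Rightarrow> 'n) \<Rightarrow> 'n \<Rightarrow> 'n" where
  "rho \<theta> = \<theta> \<circ> inv (tau (x0 \<triangleleft> \<theta>))"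

text \<open>U with x and the permuted U with the permuted x give the same matrix, so the two
  formulas for its image agree; both sides are its spectral idempotent for the eigenvalue with index
  \<open>\<theta> k\<close>.\<close>

lemma P_tau:
  assumes "x \<in> config_space X" "bij \<theta>" "unitary U"
  shows "P (tau x (\<theta> k)) U = P (tau (x \<triangleleft> \<theta>) k) (permute_columns U \<theta>)"
proof -
  define p where "p = lagrange x (\<theta> k)"
  have 1: "poly p (x $ j) = (if \<theta> k = j then 1 else 0)" for j
    using assms(1) by (simp add: p_def poly_lagrange config_inj)
  have 2: "poly p ((x \<triangleleft> \<theta>) $ j) = (if k = j then 1 else 0)" for j
    using 1[of "\<theta> j"] assms(2) by (auto simp: perm_act_def dest: bij_is_inj injD)
  have x\<theta>: "x \<triangleleft> \<theta> \<in> config_space X"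
    using assms perm_act_config_space by blast
  have U\<theta>: "unitary (permute_columns U \<theta>)"
    using assms unitary_permute_columns by blast
  have "S (tau x) x U = S (tau (x \<triangleleft> \<theta>)) (x \<triangleleft> \<theta>) (permute_columns U \<theta>)"
    using \<phi>_tau[OF assms(1,3)] \<phi>_tau[OF x\<theta> U\<theta>] unidiag_permute_columns[OF assms(3,2)] by simp
  then show ?thesis
    using matpoly_S[OF assms(3) bij_tau[OF assms(1)] 1] matpoly_S[OF U\<theta> bij_tau[OF x\<theta>] 2] by simp
qed

lemma bij_rho: "bij \<theta> \<Longrightarrow> bij (rho \<theta>)"
  unfolding rho_def using bij_tau perm_act_config_space x0 bij_imp_bij_inv bij_comp by metis

text \<open>The relabelling of the idempotents under a permutation of columns does not depend on U,
  which is what makes \<open>rho\<close> multiplicative.\<close>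

lemma P_permute_columns:
  assumes "bij \<theta>" "unitary U"
  shows "P j (permute_columns U \<theta>) = P (rho \<theta> j) U"
proof -
  have b: "bij (tau (x0 \<triangleleft> \<theta>))"
    using bij_tau perm_act_config_space x0 assms by blast
  then have "tau (x0 \<triangleleft> \<theta>) (inv (tau (x0 \<triangleleft> \<theta>)) j) = j"
    by (metis bij_inv_eq_iff)
  then show ?thesis
    using P_tau[OF x0 assms, of "inv (tau (x0 \<triangleleft> \<theta>)) j"] by (simp add: rho_def tau_x0)
qed

text \<open>Both sides label the same idempotent at U = 1, and different labels give different
  idempotents.\<close>

lemma tau_perm_act:
  assumes "x \<in> config_space X" "bij \<theta>"
  shows "rho \<theta> \<circ> tau (x \<triangleleft> \<theta>) = tau x \<circ> \<theta>"
proof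
  fix k
  have "P (rho \<theta> (tau (x \<triangleleft> \<theta>) k)) (mat 1) = P (tau x (\<theta> k)) (mat 1)"
    using P_tau[OF assms, of "mat 1"] P_permute_columns[OF assms(2), of "mat 1"] by simp
  then show "(rho \<theta> \<circ> tau (x \<triangleleft> \<theta>)) k = (tau x \<circ> \<theta>) k"
    using P_inj[OF unitary_mat_1] by simp
qed

lemma rho_hom:
  assumes "bij \<theta>" "bij \<eta>"
  shows "rho (\<theta> \<circ> \<eta>) = rho \<theta> \<circ> rho \<eta>"
proof
  fix j
  have "P (rho (\<theta> \<circ> \<eta>) j) (mat 1) = P j (permute_columns (permute_columns (mat 1) \<theta>) \<eta>)"
    using assms P_permute_columns[of "\<theta> \<circ> \<eta>" "mat 1"] by (simp add: bij_comp permute_columns_comp)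
  also have "\<dots> = P (rho \<theta> (rho \<eta> j)) (mat 1)"
    using assms by (simp add: P_permute_columns unitary_permute_columns)
  finally show "rho (\<theta> \<circ> \<eta>) j = (rho \<theta> \<circ> rho \<eta>) j"
    using P_inj[OF unitary_mat_1] by simp
qed

lemma \<phi>_closure:
  assumes "Z \<subseteq> config_space X" "\<And>z. z \<in> Z \<Longrightarrow> tau z = \<tau>"
    and "y \<in> top_of_set (power_space X) closure_of Z" "unitary U"
  shows "\<phi> (unidiag U y) = S \<tau> y U"
proof -
  have "closedin (top_of_set (power_space X)) {z \<in> power_space X. \<phi> (unidiag U z) - S \<tau> z U = 0}"
    by (intro continuous_closedin_preimage_constant continuous_on_diff continuous_on_S continuous_on_\<phi> continuous_intros)
      (use assms(4) in auto)
  moreover have "Z \<subseteq> {z \<in> power_space X. \<phi> (unidiag U z) - S \<tau> z U = 0}"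
    using assms(1,2,4) \<phi>_tau config_power by (auto dest!: subsetD)
  ultimately have "y \<in> {z \<in> power_space X. \<phi> (unidiag U z) - S \<tau> z U = 0}"
    using closure_of_minimal assms(3) by blast
  then show ?thesis
    by simp
qed

text \<open>The point y of the edge is a limit of two components, with permutations id and \<tau>,
  and by continuity both formulas hold at y. Hence \<tau> can only move an index to one with an
  equal coordinate of y, that is, interchange i and j.\<close>

lemma rho_edge:
  assumes "i \<noteq> j" "{i, j} \<in> point_graph X x0"
  shows "rho (Transposition.transpose i j) = Transposition.transpose i j \<or> rho (Transposition.transpose i j) = id"
proof -
  define C where "C = connected_component_set (config_space X) x0"
  \<comment> \<open>The edge is an unordered pair, so its witnesses may come in the other order; the
    transposition is the same.\<close>
  have "\<exists>i' j' y. {i, j} = {i', j'} \<and>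
     y \<in> top_of_set (power_space X) closure_of C \<and>
     y \<in> top_of_set (power_space X) closure_of (C \<triangleleft>\<triangleleft> Transposition.transpose i' j') \<and>
     coincidences y = {{i', j'}}"
    using assms(2) unfolding point_graph_def component_graph_def C_def by blast
  then obtain y where y: "y \<in> top_of_set (power_space X) closure_of C"
     "y \<in> top_of_set (power_space X) closure_of (C \<triangleleft>\<triangleleft> Transposition.transpose i j)"
     "coincidences y = {{i, j}}"
    by (metis doubleton_eq_iff transpose_commute)
  define t where "t = Transposition.transpose i j"
  have t: "bij t"
    by (simp add: t_def)
  define \<tau> where "\<tau> = tau (x0 \<triangleleft> t)"
  have b\<tau>: "bij \<tau>"
    unfolding \<tau>_def using bij_tau perm_act_config_space x0 t by blast
  have C: "connected C" "C \<subseteq> config_space X" "x0 \<in> C"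
    using x0 by (auto simp: C_def connected_component_subset)
  have tau_C: "tau x = id" if "x \<in> C" for x
    using tau_connected[OF C(1,2) that C(3)] tau_x0 by simp
  \<comment> \<open>Equivariance gives \<open>rho t \<circ> tau z = t\<close> for every z here, and
    \<open>rho t\<close> can be cancelled.\<close>
  have "tau z = \<tau>" if z: "z \<in> C \<triangleleft>\<triangleleft> t" for z
  proof -
    obtain x where x: "x \<in> C" "z = x \<triangleleft> t"
      using z unfolding perm_act_set_def by blast
    then have "rho t \<circ> tau z = rho t \<circ> \<tau>"
      using tau_perm_act[of x t] tau_perm_act[of x0 t] C t tau_C[of x] tau_C[of x0] by (simp add: \<tau>_def subset_iff)
    then show ?thesis
      using bij_is_inj[OF bij_rho[OF t]] by (metis fun.inj_map_strong inj_eq comp_apply ext)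
  qed
  moreover have "C \<triangleleft>\<triangleleft> t \<subseteq> config_space X"
    using C(2) perm_act_config_space t by (auto simp: perm_act_set_def)
  ultimately have "S id y (mat 1) = S \<tau> y (mat 1)"
    using \<phi>_closure[OF C(2) tau_C y(1) unitary_mat_1] \<phi>_closure[OF _ _ y(2)[folded t_def] unitary_mat_1, of \<tau>] by simp
  then have y\<tau>: "y $ \<tau> k = y $ k" for k
    using S_eqD[OF unitary_mat_1 bij_id b\<tau>, of y y "\<tau> k" k] by simp
  have move: "{\<tau> k, k} = {i, j}" if "\<tau> k \<noteq> k" for k
  proof -
    have "{\<tau> k, k} \<in> coincidences y"
      using that y\<tau> unfolding coincidences_def by blast
    then show ?thesis
      using y(3) by simp
  qed
  have inj: "inj \<tau>"
    using b\<tau> bij_is_inj by blast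
  have "\<tau> = id \<or> \<tau> = t"
  proof (cases "\<tau> i = i")
    case True
    then have "\<tau> k = k" for k
      using move[of k] inj by (metis doubleton_eq_iff injD)
    then show ?thesis
      by auto
  next
    case False
    then have i: "\<tau> i = j"
      using move[of i] by (metis doubleton_eq_iff)
    then have "\<tau> j \<noteq> j"
      using inj assms(1) by (metis injD)
    then have "\<tau> j = i"
      using move[of j] by (metis doubleton_eq_iff)
    moreover have "\<tau> k = k" if "k \<noteq> i" "k \<noteq> j" for k
      using move[of k] that by (metis doubleton_eq_iff)
    ultimately have "\<tau> = t"
      using i by (auto simp: t_def fun_eq_iff Transposition.transpose_def)
    then show ?thesis
      by simp
  qed
  then show ?thesis
    unfolding rho_def t_def[symmetric] \<tau>_def[symmetric] by (auto simp: t_def)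
qed

lemma \<phi>_diagonalization:
  assumes perfect: "perfect_set X"
    and cycle: "contains_cycle CARD('n) (point_graph X x0)"
    and trans: "transitive_on_components (config_space X :: (complex^'n) set)"
    and free: "\<not> free_on_components (config_space X :: (complex^'n) set)"
    and "x \<in> power_space X" "unitary U"
  shows "\<phi> (unidiag U x) = S id x U"
proof -
  obtain D \<theta> where D: "D \<in> components (config_space X :: (complex^'n) set)" and \<theta>: "bij \<theta>" "D \<triangleleft>\<triangleleft> \<theta> = D" "\<theta> \<noteq> id"
    using free by (auto simp: free_on_components_def permutes_UNIV_iff)
  obtain x1 where x1: "x1 \<in> D"
    using in_components_nonempty[OF D] by blast
  have "x1 \<triangleleft> \<theta> \<in> D"
    using x1 \<theta>(2) by (auto simp: perm_act_set_def)
  then have "tau (x1 \<triangleleft> \<theta>) = tau x1"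
    using tau_connected[OF in_components_connected[OF D] in_components_subset[OF D]] x1 by blast
  \<comment> \<open>Equal values of \<open>tau\<close> at \<open>x1\<close> and its translate turn
    equivariance into a conjugation of \<open>rho \<theta>\<close> to \<theta>.\<close>
  then have "rho \<theta> \<circ> tau x1 = tau x1 \<circ> \<theta>"
    using tau_perm_act[of x1 \<theta>] x1 \<theta>(1) in_components_subset[OF D] by auto
  moreover have "inj (tau x1)"
    using bij_tau x1 in_components_subset[OF D] bij_is_inj by blast
  ultimately have "rho \<theta> \<noteq> id"
    using \<theta>(3) by (metis comp_apply ext id_apply injD)
  then have rho: "rho \<eta> = \<eta>" if "bij \<eta>" for \<eta>
    using perm_endomorphism_trivial[of rho, OF bij_rho rho_hom cycle rho_edge \<theta>(1) _ that] by blast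
  \<comment> \<open>With \<open>rho\<close> the identity, equivariance carries
    \<open>tau = id\<close> from the component of \<open>x0\<close> to each of its translates, and
    by transitivity these are all components.\<close>
  have tau: "tau z = id" if z: "z \<in> config_space X" for z
  proof -
    have "connected_component_set (config_space X) x0 \<in> components (config_space X)"
      "connected_component_set (config_space X) z \<in> components (config_space X)"
      using x0 z by (auto intro: componentsI)
    then obtain \<eta> where \<eta>: "bij \<eta>"
      "connected_component_set (config_space X) x0 \<triangleleft>\<triangleleft> \<eta> = connected_component_set (config_space X) z"
      using trans unfolding transitive_on_components_def permutes_UNIV_iff by blast
    have "z \<in> connected_component_set (config_space X) z"
      using z by simp
    then obtain x where x: "x \<in> connected_component_set (config_space X) x0" "z = x \<triangleleft> \<eta>"
      unfolding \<eta>(2)[symmetric] by (auto simp: perm_act_set_def)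
    have "tau x = tau x0"
      using x(1) x0 by (intro tau_connected[of "connected_component_set (config_space X) x0"])
        (auto simp: connected_component_subset)
    moreover have "x \<in> config_space X"
      using x(1) connected_component_subset by blast
    ultimately have "\<eta> \<circ> tau z = \<eta>"
      using tau_perm_act[of x \<eta>] \<eta>(1) rho x(2) by (simp add: tau_x0)
    then show ?thesis
      using bij_is_inj[OF \<eta>(1)] by (metis comp_apply ext id_apply injD)
  qed
  show ?thesis
    using \<phi>_closure[of "config_space X" id x U] tau config_space_dense[OF perfect assms(5)] assms(6)
    by blast
qed

end

section \<open>Idempotents determined by a single column\<close>

definition rank_one :: "complex^'n \<Rightarrow> complex^'n^'n" where
  "rank_one u = (\<chi> r c. u $ r * cnj (u $ c))"

lemma rank_one_mult: "rank_one u *v v = cinner u v *s u"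
  by (simp add: vec_eq_iff rank_one_def matrix_vector_mult_def cinner_def sum_distrib_left mult_ac)

lemma continuous_on_rank_one [continuous_intros]:
  "continuous_on A f \<Longrightarrow> continuous_on A (\<lambda>t. rank_one (f t))"
  unfolding rank_one_def by (intro continuous_intros)

text \<open>The left-hand side sees only the i-th column, so the image of a matrix with eigenvalue
  \<open>a\<close> on one line and \<open>b\<close> on its complement cannot depend on the other
  columns.\<close>

lemma two_valued_unidiag:
  assumes "unitary U"
  shows "mat b + mat (a - b) ** rank_one (column i U) = unidiag U (\<chi> k. if k = i then a else b)"
  using assms
  by (intro unidiag_eqI)
    (auto simp: matrix_vector_mult_add_rdistrib rank_one_mult unitary_columns vector_sub_rdistrib
      simp flip: matrix_vector_mul_assoc)

lemma CS_preserver_frame: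
  fixes \<phi> :: "complex^'n^'n \<Rightarrow> complex^'n^'n"
  assumes card: "CARD('n) \<ge> 3" and perfect: "perfect_set X"
    and cycle: "\<forall>x \<in> (config_space X :: (complex^'n) set). contains_cycle CARD('n) (point_graph X x)"
    and trans: "transitive_on_components (config_space X :: (complex^'n) set)"
    and free: "\<not> free_on_components (config_space X :: (complex^'n) set)"
    and cont: "continuous_on (normal_matrices X) \<phi>" and CS: "CS_preserver (normal_matrices X) \<phi>"
  obtains Q where "continuous_on {u. norm u = 1} Q"
    "\<And>U. unitary U \<Longrightarrow> \<exists>V. invertible V \<and> (\<forall>i j. Q (column i U) *v column j V = (if i = j then column j V else 0))"
    "\<And>U x. unitary U \<Longrightarrow> x \<in> power_space X \<Longrightarrow> \<phi> (unidiag U x) = (\<Sum>i\<in>UNIV. mat (x $ i) ** Q (column i U))"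
proof -
  obtain D where "D \<in> components (config_space X :: (complex^'n) set)"
    using free by (auto simp: free_on_components_def)
  then obtain x0 :: "complex^'n" where x0: "x0 \<in> config_space X"
    using in_components_nonempty in_components_subset by blast
  interpret cs_map X \<phi> x0
    by unfold_locales (fact cont CS x0)+
  have \<phi>: "\<phi> (unidiag U x) = S id x U" if "x \<in> power_space X" "unitary U" for x U
    using \<phi>_diagonalization[OF perfect _ trans free that] cycle x0 by blast
  obtain i0 j0 :: 'n where ij: "i0 \<noteq> j0"
    using card by (metis card_1_singleton_iff card_le_Suc0_iff_eq finite_class.finite_UNIV UNIV_I Suc_leD numeral_3_eq_3 not_less_eq_eq)
  \<comment> \<open>Any two distinct points of X would serve; two coordinates of \<open>x0\<close>
    are at hand.\<close>
  define a b where "a = x0 $ i0" "b = x0 $ j0"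
  have ab: "a \<in> X" "b \<in> X" "a \<noteq> b"
    using x0_power inj_x0 ij by (auto simp: a_b_def power_space_def dest: injD)
  define y :: "'n \<Rightarrow> complex^'n" where "y i = (\<chi> k. if k = i then a else b)" for i
  have y: "y i \<in> power_space X" for i
    using ab by (simp add: y_def power_space_def)
  \<comment> \<open>At \<open>y i\<close> the image is b + (a - b) P, where P is the i-th
    idempotent, because the idempotents sum to 1; this is solved for P.\<close>
  define Q where "Q u = mat (1 / (a - b)) ** (\<phi> (mat b + mat (a - b) ** rank_one u) - mat b)" for u
  have Q: "Q (column i U) = P i U" if U: "unitary U" for U i
  proof -
    obtain V where V: "invertible V" "\<And>i j. P i U *v column j V = (if i = j then column j V else 0)"
      using eigenbasis_B[OF U] by metis
    show ?thesis
    proof (rule matrix_eq_on_columns[OF V(1)])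
      fix j
      have "S id (y i) U *v column j V = y i $ j *s column j V"
        using S_column[OF V(2) bij_id, of "y i" j] by simp
      then show "Q (column i U) *v column j V = P i U *v column j V"
        using ab U \<phi>[OF y U, of i]
        by (auto simp: Q_def two_valued_unidiag y_def V(2) matrix_vector_mult_diff_rdistrib vector_smult_assoc
            simp flip: matrix_vector_mul_assoc vector_sub_rdistrib)
    qed
  qed
  have "continuous_on {u. norm u = 1} (\<lambda>u. \<phi> (mat b + mat (a - b) ** rank_one u))"
  proof (rule continuous_on_compose2[OF cont])
    show "continuous_on {u. norm u = 1} (\<lambda>u. mat b + mat (a - b) ** rank_one u :: complex^'n^'n)"
      by (intro continuous_intros)
    show "(\<lambda>u. mat b + mat (a - b) ** rank_one u) ` {u. norm u = 1} \<subseteq> (normal_matrices X :: (complex^'n^'n) set)"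
    proof safe
      fix u :: "complex^'n" assume "norm u = 1"
      then obtain U where "unitary U" "column i0 U = u"
        using orthonormal_extend[of "{i0}" "\<lambda>_. u"] by (metis cinner_self_eq_1 insertI1 singletonD)
      then show "mat b + mat (a - b) ** rank_one u \<in> normal_matrices X"
        using two_valued_unidiag[of U b a i0] y[of i0] by (simp add: unidiag_normal_matrices y_def)
    qed
  qed
  then have "continuous_on {u. norm u = 1} Q"
    unfolding Q_def by (intro continuous_intros)
  moreover have "\<exists>V. invertible V \<and> (\<forall>i j. Q (column i U) *v column j V = (if i = j then column j V else 0))"
    if "unitary U" for U
    using eigenbasis_B[OF that] Q[OF that] by metis
  moreover have "\<phi> (unidiag U x) = (\<Sum>i\<in>UNIV. mat (x $ i) ** Q (column i U))"
    if "unitary U" "x \<in> power_space X" for U x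
    using \<phi>[OF that(2,1)] Q[OF that(1)] by (simp add: S_def)
  ultimately show thesis
    using that by blast
qed

subsection \<open>Maps carrying orthonormal frames to bases\<close>

text \<open>The rationals are fixed by algebra and the reals by continuity; the only freedom left is
  the choice of a square root of -1 as the value at \<i>.\<close>

lemma continuous_field_endomorphism:
  fixes h :: "complex \<Rightarrow> complex"
  assumes cont: "continuous_on UNIV h"
    and add: "\<And>x y. h (x + y) = h x + h y"
    and mult: "\<And>x y. h (x * y) = h x * h y"
    and one: "h 1 = 1"
  shows "h = (\<lambda>z. z) \<or> h = cnj"
proof -
  have zero: "h 0 = 0"
    using add[of 0 0] by simp
  have minus: "h (- x) = - h x" for x
    using add[of x "- x"] zero by (simp add: eq_neg_iff_add_eq_0 add.commute)
  have nat: "h (of_nat k) = of_nat k" for k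
    by (induction k) (simp_all add: add one zero)
  have int: "h (of_int k) = of_int k" for k
    by (cases k) (simp_all add: nat minus del: of_nat_Suc)
  have rat: "h (of_real r) = of_real r" if r: "r \<in> \<rat>" for r
  proof -
    obtain a b :: int where ab: "b > 0" "r = of_int a / of_int b"
      using Rats_cases'[OF r] by metis
    have "h (of_real r) * of_int b = h (of_real r * of_int b)"
      by (simp add: mult int)
    also have "\<dots> = of_real r * of_int b"
      using ab by (simp add: int)
    finally show ?thesis
      using ab(1) by (simp only: mult_cancel_right) simp
  qed
  have "closed {r. h (of_real r) = of_real r}"
    by (intro closed_Collect_eq continuous_intros continuous_on_compose2[OF cont]) auto
  then have "closure \<rat> \<subseteq> {r. h (of_real r) = of_real r}"
    using rat by (intro closure_minimal) auto
  then have real: "h (of_real r) = of_real r" for r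
    unfolding Rats_closure_real by blast
  have "h \<i> * h \<i> = -1"
    by (simp add: one minus flip: mult)
  then have "(h \<i> - \<i>) * (h \<i> + \<i>) = 0"
    by (simp add: algebra_simps)
  then have "h \<i> = \<i> \<or> h \<i> = - \<i>"
    by (simp add: eq_neg_iff_add_eq_0)
  moreover have h: "h z = of_real (Re z) + h \<i> * of_real (Im z)" for z
    by (metis add complex_eq mult real)
  ultimately show ?thesis
  proof (elim disjE)
    assume i: "h \<i> = \<i>"
    have "h z = z" for z
      unfolding h[of z] by (simp add: i flip: complex_eq)
    then show ?thesis
      by blast
  next
    assume i: "h \<i> = - \<i>"
    have "h z = cnj z" for z
      unfolding h[of z] by (simp add: i complex_eq_iff)
    then show ?thesis
      by blast
  qed
qed

definition normalize_vec :: "complex^'n \<Rightarrow> complex^'n" where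
  "normalize_vec x = complex_of_real (1 / norm x) *s x"

lemma norm_normalize_vec: "x \<noteq> 0 \<Longrightarrow> norm (normalize_vec x) = 1"
  unfolding normalize_vec_def by (rule norm_normalize)

lemma normalize_vec_unit: "norm x = 1 \<Longrightarrow> normalize_vec x = x"
  by (simp add: normalize_vec_def)

lemma cinner_normalize_vec:
  "y \<noteq> 0 \<Longrightarrow> cinner x (normalize_vec y) = 0 \<longleftrightarrow> cinner x y = 0"
  by (simp add: normalize_vec_def cinner_scale_right)

lemma continuous_on_normalize_vec:
  "continuous_on {x :: complex^'n. x \<noteq> 0} normalize_vec"
proof -
  have "continuous_on {x :: complex^'n. x \<noteq> 0} (\<lambda>x. (1 / norm x) *\<^sub>R x)"
    by (intro continuous_intros) auto
  then show ?thesis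
    by (simp add: scaleR_eq_scale normalize_vec_def[abs_def] del: of_real_divide)
qed

lemma ex_other_two:
  fixes i j :: "'n::finite"
  assumes "CARD('n) \<ge> 3"
  obtains k where "k \<noteq> i" "k \<noteq> j"
proof -
  have "card {i, j} \<le> 2"
    by (simp add: card_insert_if)
  then have "UNIV \<noteq> {i, j}"
    using assms by (metis not_less_eq_eq numeral_2_eq_2 numeral_3_eq_3 order_trans)
  then show thesis
    using that by blast
qed

section \<open>The map on lines induced by a frame map\<close>

locale frame_map =
  fixes Q :: "complex^'n \<Rightarrow> complex^'n^'n"
  assumes card3: "CARD('n) \<ge> 3"
    and continuous_Q: "continuous_on {u. norm u = 1} Q"
    and frame: "unitary U \<Longrightarrow> \<exists>V. invertible V \<and>
      (\<forall>i j. Q (column i U) *v column j V = (if i = j then column j V else 0))"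
begin

lemma
  assumes "unitary U"
  shows frame_mult: "Q (column i U) *v (Q (column j U) *v v) = (if i = j then Q (column i U) *v v else 0)"
    and frame_sum: "(\<Sum>i\<in>UNIV. Q (column i U) *v v) = v"
    and frame_range: "\<exists>w. w \<noteq> 0 \<and> Q (column i U) *v w = w \<and> (\<forall>v. \<exists>c. Q (column i U) *v v = c *s w)"
proof -
  obtain V where V: "invertible V" "\<And>i j. Q (column i U) *v column j V = (if i = j then column j V else 0)"
    using frame[OF assms] by blast
  have Q: "Q (column i U) *v v = (matrix_inv V *v v) $ i *s column i V" for i v
  proof -
    have "v = V *v (matrix_inv V *v v)"
      by (simp add: matrix_vector_mul_assoc invertible_matrix_inv V(1))
    also have "\<dots> = (\<Sum>j\<in>UNIV. (matrix_inv V *v v) $ j *s column j V)"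
      by (rule matrix_mult_sum)
    finally have "Q (column i U) *v v = Q (column i U) *v (\<Sum>j\<in>UNIV. (matrix_inv V *v v) $ j *s column j V)"
      by (rule arg_cong)
    also have "\<dots> = (\<Sum>j\<in>UNIV. (matrix_inv V *v v) $ j *s (Q (column i U) *v column j V))"
      by (simp add: matrix_vector_mult_scale matrix_vector_mult_sum_right)
    finally show ?thesis
      by (simp add: V(2) if_distrib[of "\<lambda>x. _ *s x"] cong: if_cong)
  qed
  have inv: "matrix_inv V *v column j V = axis j 1" for j
    unfolding matrix_mult_column[symmetric] invertible_matrix_inv(2)[OF V(1)]
    by (simp add: column_def mat_def axis_def vec_eq_iff)
  show "Q (column i U) *v (Q (column j U) *v v) = (if i = j then Q (column i U) *v v else 0)"
    by (simp add: Q[of j] matrix_vector_mult_scale V(2))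
  show "(\<Sum>i\<in>UNIV. Q (column i U) *v v) = v"
    unfolding Q matrix_mult_sum[symmetric]
    by (simp add: matrix_vector_mul_assoc invertible_matrix_inv V(1))
  have "column i V \<noteq> 0"
    using V(1) unfolding invertible_iff_trivial_kernel matrix_vector_mult_axis[symmetric]
    by (metis axis_eq_0_iff one_neq_zero)
  then show "\<exists>w. w \<noteq> 0 \<and> Q (column i U) *v w = w \<and> (\<forall>v. \<exists>c. Q (column i U) *v v = c *s w)"
    using V(2)[of i i] Q by (intro exI[of _ "column i V"]) auto
qed

definition q :: "complex^'n \<Rightarrow> complex^'n^'n" where
  "q x = Q (normalize_vec x)"

text \<open>A generator of the image line. The choice depends on x only through \<open>q x\<close>,
  so proportional vectors have literally the same \<open>g\<close>; as an arbitrary choice it need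
  not be continuous, and continuity is always argued through \<open>q\<close>.\<close>

definition g :: "complex^'n \<Rightarrow> complex^'n" where
  "g x = (SOME v. v \<noteq> 0 \<and> q x *v v = v)"

lemma ex_unitary_column:
  assumes "norm u = 1"
  obtains U where "unitary U" "column i U = u"
  using orthonormal_extend[of "{i}" "\<lambda>_. u"] assms by (metis cinner_self_eq_1 insertI1 singletonD)

lemma ex_unitary_columns:
  assumes "a \<noteq> 0" "b \<noteq> 0" "cinner a b = 0" "i \<noteq> j"
  obtains U where "unitary U" "column i U = normalize_vec a" "column j U = normalize_vec b"
proof -
  have 0: "cinner (normalize_vec a) (normalize_vec b) = 0"
    using assms by (simp add: normalize_vec_def cinner_scale_left cinner_scale_right)
  then have "cinner (normalize_vec b) (normalize_vec a) = 0"
    using cinner_commute_zero by blast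
  with 0 have "cinner (if k = i then normalize_vec a else normalize_vec b)
      (if l = i then normalize_vec a else normalize_vec b) = (if k = l then 1 else 0)"
    if "k \<in> {i, j}" "l \<in> {i, j}" for k l
    using assms norm_normalize_vec that by (auto simp: cinner_self_eq_1)
  then obtain U where "unitary U" "\<And>k. k \<in> {i, j} \<Longrightarrow> column k U = (if k = i then normalize_vec a else normalize_vec b)"
    using orthonormal_extend[of "{i, j}" "\<lambda>k. if k = i then normalize_vec a else normalize_vec b"]
    by metis
  then show thesis
    using that assms(4) by (metis insertI1 insertI2)
qed

lemma
  assumes "x \<noteq> 0"
  shows g_nonzero: "g x \<noteq> 0"
    and q_g: "q x *v g x = g x"
    and q_range: "\<exists>c. q x *v v = c *s g x"
proof -
  obtain U i where U: "unitary U" "column i U = normalize_vec x"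
    using ex_unitary_column norm_normalize_vec[OF assms] by metis
  obtain w where w: "w \<noteq> 0" "q x *v w = w" "\<And>v. \<exists>c. q x *v v = c *s w"
    using frame_range[OF U(1), of i] unfolding U(2) q_def[symmetric] by blast
  have g: "g x \<noteq> 0 \<and> q x *v g x = g x"
    unfolding g_def by (rule someI[of _ w]) (use w in auto)
  then show "g x \<noteq> 0" "q x *v g x = g x"
    by auto
  obtain a where a: "g x = a *s w"
    using w(3) g by metis
  then have "a \<noteq> 0"
    using g by auto
  obtain c where "q x *v v = c *s w"
    using w(3) by blast
  then have "q x *v v = (c / a) *s g x"
    using a \<open>a \<noteq> 0\<close> by (simp add: vector_smult_assoc)
  then show "\<exists>c. q x *v v = c *s g x"
    by blast
qed

lemma q_idem: "x \<noteq> 0 \<Longrightarrow> q x *v (q x *v v) = q x *v v"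
  by (metis matrix_vector_mult_scale q_g q_range)

lemma q_orthogonal:
  assumes "x \<noteq> 0" "y \<noteq> 0" "cinner x y = 0"
  shows "q x *v (q y *v v) = 0"
proof -
  obtain i j :: 'n where ij: "i \<noteq> j"
    using ex_other_two[OF card3] by metis
  then obtain U where "unitary U" "column i U = normalize_vec x" "column j U = normalize_vec y"
    using ex_unitary_columns[OF assms] by metis
  then show ?thesis
    using frame_mult[of U i j] ij by (simp add: q_def)
qed

lemma q_g_orthogonal: "x \<noteq> 0 \<Longrightarrow> y \<noteq> 0 \<Longrightarrow> cinner x y = 0 \<Longrightarrow> q x *v g y = 0"
  by (metis q_g q_orthogonal)

text \<open>The idempotents of a frame sum to 1, so each is determined by the others, and these do
  not change when one column is multiplied by a phase.\<close>

lemma q_scale: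
  assumes "c \<noteq> 0" "x \<noteq> 0"
  shows "q (c *s x) = q x"
proof -
  \<comment> \<open>Normalization removes the modulus of c; only its phase remains.\<close>
  define e where "e = c / complex_of_real (norm c)"
  have e: "norm e = 1"
    using assms(1) by (simp add: e_def norm_divide)
  have norm_cx: "norm (c *s x) = norm c * norm x"
  proof -
    have "complex_of_real ((norm (c *s x))\<^sup>2) = cnj c * c * cinner x x"
      by (simp only: cinner_self[symmetric] cinner_scale_left cinner_scale_right mult_ac)
    also have "\<dots> = complex_of_real ((norm c * norm x)\<^sup>2)"
      by (simp add: cinner_self power_mult_distrib complex_norm_square del: of_real_power)
    finally show ?thesis
      by (simp only: of_real_eq_iff) simp
  qed
  have cx: "normalize_vec (c *s x) = e *s normalize_vec x"
    using assms by (simp add: normalize_vec_def norm_cx vector_smult_assoc e_def)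
  obtain U and i :: 'n where U: "unitary U" "column i U = normalize_vec x"
    using ex_unitary_column norm_normalize_vec[OF assms(2)] by metis
  define U' where "U' = U ** diag (\<chi> k. if k = i then e else 1)"
  have col: "column k U' = (if k = i then e *s column k U else column k U)" for k
    by (simp add: U'_def column_mult_diag)
  have "cnj e * e = 1"
    using e by (metis complex_norm_square mult.commute norm_one of_real_1 one_power2)
  then have U': "unitary U'"
    using U(1) by (auto simp: unitary_columns col cinner_scale_left cinner_scale_right)
  show ?thesis
  proof (subst matrix_eq, safe)
    fix v
    have "(\<Sum>k\<in>UNIV-{i}. Q (column k U') *v v) = (\<Sum>k\<in>UNIV-{i}. Q (column k U) *v v)"
      by (intro sum.cong) (auto simp: col)
    then have "q (c *s x) *v v + (\<Sum>k\<in>UNIV-{i}. Q (column k U) *v v) = v"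
      using frame_sum[OF U', of v] U(2)
      by (subst (asm) sum.remove[of _ i]) (auto simp: q_def cx col)
    moreover have "q x *v v + (\<Sum>k\<in>UNIV-{i}. Q (column k U) *v v) = v"
      using frame_sum[OF U(1), of v] U(2)
      by (subst (asm) sum.remove[of _ i]) (auto simp: q_def)
    ultimately show "q (c *s x) *v v = q x *v v"
      by (metis add_right_cancel)
  qed
qed

lemma g_scale: "c \<noteq> 0 \<Longrightarrow> x \<noteq> 0 \<Longrightarrow> g (c *s x) = g x"
  unfolding g_def by (simp add: q_scale)

text \<open>Complete a and b to an orthogonal frame. The remaining columns are orthogonal to a + b,
  so their idempotents kill \<open>g (a + b)\<close>, and in the decomposition of 1 only the two
  idempotents of a and b contribute.\<close>

lemma g_split:
  assumes "a \<noteq> 0" "b \<noteq> 0" "cinner a b = 0"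
  obtains \<alpha> \<beta> where "g (a + b) = \<alpha> *s g a + \<beta> *s g b"
proof -
  obtain i j :: 'n where ij: "i \<noteq> j"
    using ex_other_two[OF card3] by metis
  then obtain U where U: "unitary U" "column i U = normalize_vec a" "column j U = normalize_vec b"
    using ex_unitary_columns[OF assms] by metis
  have ba: "cinner b a = 0"
    using assms(3) cinner_commute_zero by blast
  have ab: "a + b \<noteq> 0"
    by (metis assms(1,3) add.right_neutral cinner_add_right cinner_self_eq_0 cinner_zero(1))
  have 0: "Q (column k U) *v g (a + b) = 0" if "k \<noteq> i" "k \<noteq> j" for k
  proof -
    have u: "norm (column k U) = 1"
      using U(1) by (simp add: unitary_columns cinner_self_eq_1[symmetric])
    have "cinner (column k U) (normalize_vec a) = 0" "cinner (column k U) (normalize_vec b) = 0"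
      using U that unfolding unitary_columns by metis+
    then have "cinner (column k U) (a + b) = 0"
      using assms by (simp add: cinner_normalize_vec cinner_add_right)
    then have "q (column k U) *v g (a + b) = 0"
      using u ab by (intro q_g_orthogonal) auto
    then show ?thesis
      by (simp add: q_def normalize_vec_unit u)
  qed
  have "g (a + b) = (\<Sum>k\<in>UNIV. Q (column k U) *v g (a + b))"
    by (rule frame_sum[OF U(1), symmetric])
  also have "\<dots> = (\<Sum>k\<in>{i, j}. Q (column k U) *v g (a + b))"
    using 0 by (intro sum.mono_neutral_right) auto
  also have "\<dots> = q a *v g (a + b) + q b *v g (a + b)"
    using ij U by (simp add: q_def)
  finally show thesis
    using q_range[OF assms(1)] q_range[OF assms(2)] that by metis
qed

lemma continuous_on_q: "continuous_on {x. x \<noteq> 0} q"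
  unfolding q_def[abs_def]
  by (rule continuous_on_compose2[OF continuous_Q continuous_on_normalize_vec])
    (auto simp: norm_normalize_vec)

lemma continuous_on_q_compose [continuous_intros]:
  assumes "continuous_on S f" "\<And>t. t \<in> S \<Longrightarrow> f t \<noteq> 0"
  shows "continuous_on S (\<lambda>t. q (f t))"
  by (rule continuous_on_compose2[OF continuous_on_q assms(1)]) (use assms(2) in auto)

section \<open>Injectivity of the map on lines\<close>

definition same :: "complex^'n \<Rightarrow> complex^'n \<Rightarrow> bool" where
  "same x y \<longleftrightarrow> (\<exists>c. g y = c *s g x)"

lemma same_sym: "same x y \<Longrightarrow> y \<noteq> 0 \<Longrightarrow> same y x"
proof -
  assume "same x y" "y \<noteq> 0"
  then obtain c where c: "g y = c *s g x"
    by (auto simp: same_def)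
  then have "c \<noteq> 0"
    using g_nonzero[OF \<open>y \<noteq> 0\<close>] by auto
  then have "g x = (1 / c) *s g y"
    by (simp add: c vector_smult_assoc)
  then show ?thesis
    by (auto simp: same_def)
qed

lemma same_trans: "same x y \<Longrightarrow> same y z \<Longrightarrow> same x z"
  by (auto simp: same_def vector_smult_assoc)

lemma same_iff: "x \<noteq> 0 \<Longrightarrow> same x y \<longleftrightarrow> q x *v g y = g y"
  by (metis matrix_vector_mult_scale q_g q_range same_def)

lemma same_scale: "c \<noteq> 0 \<Longrightarrow> y \<noteq> 0 \<Longrightarrow> same x (c *s y) \<longleftrightarrow> same x y"
  by (simp add: same_def g_scale)

lemma same_not_orthogonal: "same x y \<Longrightarrow> x \<noteq> 0 \<Longrightarrow> y \<noteq> 0 \<Longrightarrow> cinner x y \<noteq> 0"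
  by (metis g_nonzero q_g_orthogonal same_iff)

lemma add_orthogonal_nonzero:
  assumes "u \<noteq> 0" "cinner u w = 0"
  shows "u + t *s w \<noteq> (0 :: complex^'n)"
proof
  assume "u + t *s w = 0"
  then have "cinner u (u + t *s w) = 0"
    by simp
  then show False
    using assms by (simp add: cinner_add_right cinner_scale_right)
qed

text \<open>The image of u + w + t z is compared through its three splittings into two orthogonal summands.\<close>

lemma same_near_orthogonal:
  assumes nz: "u \<noteq> 0" "w \<noteq> 0" "z \<noteq> 0"
    and orth: "cinner u w = 0" "cinner u z = 0" "cinner w z = 0"
    and same: "same u (u + w)"
  obtains \<delta> where "\<delta> > 0" "\<And>t. norm t < \<delta> \<Longrightarrow> same u (u + t *s z)"
proof -
  have orth': "cinner w u = 0" "cinner z u = 0" "cinner z w = 0"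
    using orth cinner_commute_zero by blast+
  have wz: "w + t *s z \<noteq> 0" for t
    using add_orthogonal_nonzero[of w z] nz orth by auto
  \<comment> \<open>At t = 0 this vector is g w, so for small t it is nonzero; then the image of w +
    t z has a component along the image of w.\<close>
  have "continuous_on UNIV (\<lambda>t. q w *v (q (w + t *s z) *v g w))"
    by (intro continuous_intros) (rule wz)
  then have "open {t. q w *v (q (w + t *s z) *v g w) \<noteq> 0}"
    by (rule open_Collect_neq) (rule continuous_on_const)
  moreover have "q w *v (q (w + 0 *s z) *v g w) \<noteq> 0"
    using nz by (simp add: q_g g_nonzero)
  ultimately obtain \<delta> where \<delta>: "\<delta> > 0" "ball 0 \<delta> \<subseteq> {t. q w *v (q (w + t *s z) *v g w) \<noteq> 0}"
    by (metis (mono_tags, lifting) mem_Collect_eq open_contains_ball)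
  have "same u (u + t *s z)" if "norm t < \<delta>" for t
  proof (cases "t = 0")
    case True
    then show ?thesis
      by (auto simp: same_def intro!: exI[of _ 1])
  next
    case False
    have ne: "q w *v g (w + t *s z) \<noteq> 0"
    proof
      assume 0: "q w *v g (w + t *s z) = 0"
      obtain c where "q (w + t *s z) *v g w = c *s g (w + t *s z)"
        using q_range[OF wz] by blast
      then have "q w *v (q (w + t *s z) *v g w) = 0"
        by (simp add: 0 matrix_vector_mult_scale)
      then show False
        using \<delta>(2) that by (auto simp: subset_iff)
    qed
    have uw: "u + w \<noteq> 0"
      using add_orthogonal_nonzero[of u w 1] nz orth by auto
    have uz: "u + t *s z \<noteq> 0"
      using add_orthogonal_nonzero[of u z t] nz orth by auto
    define p where "p = u + w + t *s z"
    have p0: "p \<noteq> 0"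
      using add_orthogonal_nonzero[of "u + w" z t] uw orth by (simp add: p_def cinner_add_left)
    obtain c where c: "g (u + w) = c *s g u"
      using same by (auto simp: same_def)
    have tz: "t *s z \<noteq> 0" "g (t *s z) = g z"
      using False nz by (auto simp: g_scale)
    \<comment> \<open>Splitting (u + w) + t z: the first summand has the image line of u, so
      \<open>g p\<close> has no component along that of w.\<close>
    obtain \<alpha> \<beta> where "g p = \<alpha> *s g (u + w) + \<beta> *s g z"
      using g_split[of "u + w" "t *s z"] uw tz orth
      by (auto simp: p_def cinner_add_left cinner_scale_right)
    then have "q w *v g p = 0"
      using nz orth orth' by (simp add: c matrix_vector_right_distrib matrix_vector_mult_scale q_g_orthogonal)
    \<comment> \<open>Splitting u + (w + t z): the second summand would bring in such a component,
      so its coefficient vanishes and \<open>g p\<close> lies on the image line of u.\<close>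
    moreover obtain \<alpha>' \<beta>' where p1: "g p = \<alpha>' *s g u + \<beta>' *s g (w + t *s z)"
      using g_split[of u "w + t *s z"] nz wz orth
      by (auto simp: p_def cinner_add_right cinner_scale_right add.assoc)
    ultimately have "\<beta>' = 0"
      using nz orth orth' ne by (simp add: matrix_vector_right_distrib matrix_vector_mult_scale q_g_orthogonal)
    then have pu: "g p = \<alpha>' *s g u" "\<alpha>' \<noteq> 0"
      using p1 g_nonzero[OF p0] by auto
    \<comment> \<open>Splitting (u + t z) + w: since \<open>g p\<close> is not killed by
      \<open>q u\<close>, the first coefficient is nonzero, and since \<open>g p\<close> is killed
      by \<open>q z\<close>, so is \<open>g (u + t *s z)\<close>.\<close>
    obtain a b where ab: "g p = a *s g (u + t *s z) + b *s g w"
      using g_split[of "u + t *s z" w] nz uz orth orth'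
      by (auto simp: p_def cinner_add_left cinner_scale_left ac_simps)
    have "a \<noteq> 0"
    proof
      assume "a = 0"
      then have "g w = 0 \<or> q u *v g p = 0"
        using ab nz orth by (simp add: matrix_vector_mult_scale q_g_orthogonal)
      then show False
        using pu nz by (auto simp: g_nonzero q_g matrix_vector_mult_scale)
    qed
    moreover have "q z *v g p = 0"
      using pu nz orth' by (simp add: matrix_vector_mult_scale q_g_orthogonal)
    ultimately have 0: "q z *v g (u + t *s z) = 0"
      using nz orth' by (simp add: ab matrix_vector_right_distrib matrix_vector_mult_scale q_g_orthogonal)
    obtain a' b' where ab': "g (u + t *s z) = a' *s g u + b' *s g z"
      using g_split[of u "t *s z"] nz tz orth by (auto simp: cinner_scale_right)
    then have "b' = 0"
      using 0 nz orth' by (simp add: matrix_vector_right_distrib matrix_vector_mult_scale q_g_orthogonal q_g g_nonzero)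
    then show ?thesis
      using ab' by (auto simp: same_def)
  qed
  then show thesis
    using that \<delta>(1) by blast
qed

text \<open>A third direction z, orthogonal to u and w, is used as a detour: from u + w to a small u
  + t z, and from there, with t z in the role of w and w in that of z, to all small u + t w.\<close>

lemma same_near:
  assumes nz: "u \<noteq> 0" "w \<noteq> 0" and orth: "cinner u w = 0" and same: "same u (u + w)"
  obtains \<delta> where "\<delta> > 0" "\<And>t. norm t < \<delta> \<Longrightarrow> same u (u + t *s w)"
proof -
  obtain i j :: 'n where ij: "i \<noteq> j"
    using ex_other_two[OF card3] by metis
  obtain k where k: "k \<noteq> i" "k \<noteq> j"
    using ex_other_two[OF card3] by metis
  obtain z where z: "z \<noteq> 0" "\<And>l. l \<in> {i, j} \<Longrightarrow> cinner (if l = i then u else w) z = 0"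
    using ex_nonzero_orthogonal[of k "{i, j}" "\<lambda>l. if l = i then u else w"] k by auto
  then have z': "cinner u z = 0" "cinner w z = 0" "cinner z w = 0"
    using ij cinner_commute_zero[of w z] by force+
  obtain \<delta> where \<delta>: "\<delta> > 0" "\<And>t. norm t < \<delta> \<Longrightarrow> same u (u + t *s z)"
    using same_near_orthogonal[OF nz(1,2) z(1) orth z'(1,2) same] by metis
  define t where "t = complex_of_real (\<delta> / 2)"
  have "norm t < \<delta>" "t \<noteq> 0"
    using \<delta>(1) by (auto simp: t_def)
  then show thesis
    using same_near_orthogonal[of u "t *s z" w] nz z z' orth \<delta>(2) that
    by (auto simp: cinner_scale_left cinner_scale_right)
qed

text \<open>The base point is moved from u to u' = u + t0 w. From there u itself is, up to scale, u'
  plus a multiple of the orthogonal vector w', and it has the same image; so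
  \<open>same_near\<close> applies at u' and covers the u + t w with t near t0.\<close>

lemma same_open:
  assumes nz: "u \<noteq> 0" "w \<noteq> 0" and orth: "cinner u w = 0" and same: "same u (u + t0 *s w)" "t0 \<noteq> 0"
  obtains e where "e > 0" "\<And>t. dist t t0 < e \<Longrightarrow> same u (u + t *s w)"
proof -
  define N M where "N = cinner u u" "M = cinner w w"
  define D where "D = N + t0 * cnj t0 * M"
  \<comment> \<open>An orthogonal basis of the plane of u and w; \<open>D\<close> is the squared
    norm of u' and also the determinant of this change of basis.\<close>
  define u' w' where "u' = u + t0 *s w" "w' = N *s w - (cnj t0 * M) *s u"
  have N: "N \<noteq> 0"
    using nz by (simp add: N_M_def)
  have "D = of_real ((norm u)\<^sup>2 + (norm t0 * norm w)\<^sup>2)"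
    by (simp add: D_def N_M_def cinner_self power_mult_distrib flip: complex_norm_square)
  moreover have "(norm u)\<^sup>2 + (norm t0 * norm w)\<^sup>2 \<noteq> 0"
    using nz by (simp add: add_nonneg_eq_0_iff)
  ultimately have D: "D \<noteq> 0"
    using of_real_eq_0_iff by metis
  have orth': "cinner w u = 0"
    using orth cinner_commute_zero by blast
  have c0: "cinner u' w' = 0"
    by (simp add: u'_w'_def cinner_add_left cinner_diff_right cinner_scale_left cinner_scale_right
        orth orth' N_M_def[symmetric])
  have u': "u' \<noteq> 0"
    unfolding u'_w'_def using add_orthogonal_nonzero nz orth by blast
  have Du: "N *s u' - t0 *s w' = D *s u"
    by (simp add: vec_eq_iff u'_w'_def D_def algebra_simps)
  have Dw: "w' + (cnj t0 * M) *s u' = D *s w"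
    by (simp add: vec_eq_iff u'_w'_def D_def algebra_simps)
  have w': "w' \<noteq> 0"
  proof
    assume "w' = 0"
    then have "cinner w ((cnj t0 * M) *s u') = cinner w (D *s w)" "cinner u ((cnj t0 * M) *s u') = cinner u (D *s w)"
      using Dw by simp_all
    then show False
      using nz orth orth' N D same(2) by (simp add: cinner_scale_right u'_w'_def(1) cinner_add_right N_M_def)
  qed
  have "same u' u"
    using same nz unfolding u'_w'_def by (intro same_sym[of u]) (use u' u'_w'_def in auto)
  moreover have "D *s u = N *s (u' + (- (t0 / N)) *s w')"
    using N by (simp add: Du[symmetric] vec_eq_iff algebra_simps)
  then have "same u' (N *s (u' + (- (t0 / N)) *s w')) \<longleftrightarrow> same u' u"
    using D nz by (metis same_scale)
  ultimately have "same u' (u' + (- (t0 / N)) *s w')"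
    using same_scale[OF N add_orthogonal_nonzero[OF u' c0], of u' "- (t0 / N)"] by blast
  then obtain \<delta> where \<delta>: "\<delta> > 0" "\<And>r. norm r < \<delta> \<Longrightarrow> same u' (u' + r *s ((- (t0 / N)) *s w'))"
    using same_near[of u' "(- (t0 / N)) *s w'"] u' w' c0 same(2) N
    by (metis cinner_scale_right divide_eq_0_iff mult_zero_right neg_equal_0_iff_equal vector_mul_eq_0)
  \<comment> \<open>Expressed in u' and w', the vector D (u + t w) is \<open>den t\<close> times u'
    plus t - t0 times w'; \<open>r t\<close> is the resulting parameter for \<delta>, and it tends
    to 0 as t tends to t0.\<close>
  define den r where "den t = D + (t - t0) * cnj t0 * M" "r t = (t - t0) / den t * (- (N / t0))" for t
  have "(den \<longlongrightarrow> den t0) (at t0)"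
    unfolding den_r_def by (intro tendsto_intros)
  then have ev1: "eventually (\<lambda>t. den t \<noteq> 0) (at t0)"
    using D tendsto_imp_eventually_ne[of den "den t0"] by (simp add: den_r_def(1))
  have "(r \<longlongrightarrow> (t0 - t0) / den t0 * (- (N / t0))) (at t0)"
    unfolding den_r_def using D same(2) by (intro tendsto_intros) auto
  then have "(r \<longlongrightarrow> 0) (at t0)"
    by simp
  then have "eventually (\<lambda>t. norm (r t) < \<delta>) (at t0)"
    using tendstoD[OF _ \<delta>(1)] by fastforce
  with ev1 have "eventually (\<lambda>t. den t \<noteq> 0 \<and> norm (r t) < \<delta>) (at t0)"
    by (rule eventually_conj)
  then obtain e where e: "e > 0" "\<And>t. t \<noteq> t0 \<Longrightarrow> dist t t0 < e \<Longrightarrow> den t \<noteq> 0 \<and> norm (r t) < \<delta>"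
    by (auto simp: eventually_at)
  have "same u (u + t *s w)" if "dist t t0 < e" for t
  proof (cases "t = t0")
    case False
    then have t: "den t \<noteq> 0" "norm (r t) < \<delta>"
      using e(2) that by auto
    have "D *s (u + t *s w) = D *s u + t *s (D *s w)"
      by (simp add: vec_eq_iff algebra_simps)
    also have "\<dots> = (N *s u' - t0 *s w') + t *s (w' + (cnj t0 * M) *s u')"
      by (simp only: Du Dw)
    also have "\<dots> = den t *s u' + (t - t0) *s w'"
      by (simp add: vec_eq_iff den_r_def D_def algebra_simps)
    also have "\<dots> = den t *s (u' + r t *s ((- (t0 / N)) *s w'))"
    proof -
      have "den t * (r t * (- (t0 / N))) = t - t0"
        using t N same(2) by (simp add: den_r_def(2))
      then show ?thesis
        by (simp only: vector_add_ldistrib vector_smult_assoc)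
    qed
    finally have eq: "D *s (u + t *s w) = den t *s (u' + r t *s ((- (t0 / N)) *s w'))" .
    have "same u' (u' + r t *s ((- (t0 / N)) *s w'))"
      using \<delta>(2) t by blast
    moreover have "u' + r t *s ((- (t0 / N)) *s w') \<noteq> 0"
      using add_orthogonal_nonzero[OF u' c0, of "r t * (- (t0 / N))"] by (simp add: vector_smult_assoc)
    ultimately have "same u' (D *s (u + t *s w))"
      unfolding eq using same_scale[OF t(1)] by blast
    then have "same u' (u + t *s w)"
      using same_scale D add_orthogonal_nonzero nz orth by blast
    then show ?thesis
      using same(1) same_trans u'_w'_def(1) by blast
  qed (use same in simp)
  then show thesis
    using that e(1) by blast
qed

text \<open>The parameters t at which u + t w has the same image line as u form a closed and open set.
  If it were nonempty, then letting t tend to infinity would identify the orthogonal images of u and w.\<close>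

lemma not_same_orthogonal:
  assumes nz: "u \<noteq> 0" "w \<noteq> 0" and orth: "cinner u w = 0"
  shows "\<not> same u (u + w)"
proof
  assume same: "same u (u + w)"
  define G where "G = {t. same u (u + t *s w)}"
  have ut: "u + t *s w \<noteq> 0" for t
    using add_orthogonal_nonzero nz orth by blast
  have wt: "w + t *s u \<noteq> 0" for t
    using add_orthogonal_nonzero[of w u] nz orth cinner_commute_zero by blast
  \<comment> \<open>Symmetry puts the parameter into \<open>q\<close>, which is continuous, and
    leaves only the constant vector \<open>g u\<close> outside.\<close>
  have iff: "same u (u + t *s w) \<longleftrightarrow> q (u + t *s w) *v g u = g u" for t
    using same_iff[of "u + t *s w" u] ut same_sym nz by blast
  have "closed G"
    unfolding G_def iff by (intro closed_Collect_eq continuous_intros ut)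
  moreover have "open G"
    unfolding open_dist
  proof safe
    fix t0 assume "t0 \<in> G"
    then have t0: "same u (u + t0 *s w)"
      by (simp add: G_def)
    show "\<exists>e>0. \<forall>t. dist t t0 < e \<longrightarrow> t \<in> G"
    proof (cases "t0 = 0")
      case True
      then show ?thesis
        using same_near[OF nz orth same] by (auto simp: G_def)
    next
      case False
      then show ?thesis
        using same_open[OF nz orth t0] unfolding G_def by (metis mem_Collect_eq)
    qed
  qed
  moreover have "1 \<in> G"
    using same by (simp add: G_def)
  ultimately have "G = UNIV"
    using clopen by blast
  then have all: "same u (u + t *s w)" for t
    by (auto simp: G_def)
  \<comment> \<open>The substitution t = 1 / s brings the point at infinity to s = 0, where the
    vector becomes w.\<close>
  have "q (w + s *s u) *v g u = g u" if "s \<noteq> 0" for s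
  proof -
    have "w + s *s u = s *s (u + (1 / s) *s w)"
      using that by (simp add: vec_eq_iff algebra_simps)
    then have "q (w + s *s u) = q (u + (1 / s) *s w)"
      using q_scale[OF that ut] by metis
    then show ?thesis
      using all[of "1 / s"] iff by auto
  qed
  then have "- {0} \<subseteq> {s. q (w + s *s u) *v g u = g u}"
    by auto
  moreover have "closed {s. q (w + s *s u) *v g u = g u}"
    by (intro closed_Collect_eq continuous_intros wt)
  ultimately have "closure (- {0}) \<subseteq> {s. q (w + s *s u) *v g u = g u}"
    by (rule closure_minimal)
  then have "q (w + 0 *s u) *v g u = g u"
    unfolding closure_complement interior_singleton by blast
  then have "q w *v g u = g u"
    by simp
  then show False
    using q_g_orthogonal[of w u] g_nonzero nz orth cinner_commute_zero by metis
qed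

text \<open>Write x = c e + b with b orthogonal to e. If c is nonzero but the image of x has no
  component along that of e, then x and b share an image line, contrary to
  \<open>not_same_orthogonal\<close> for b and c e.\<close>

lemma q_g_eq_0_iff:
  assumes "e \<noteq> 0" "x \<noteq> 0"
  shows "q e *v g x = 0 \<longleftrightarrow> cinner e x = 0"
proof
  assume 0: "q e *v g x = 0"
  show "cinner e x = 0"
  proof (rule ccontr)
    assume ne: "cinner e x \<noteq> 0"
    define c where "c = cinner e x / cinner e e"
    define b where "b = x - c *s e"
    have c: "c \<noteq> 0"
      using ne assms by (simp add: c_def)
    have x: "x = c *s e + b"
      by (simp add: b_def)
    have b: "cinner e b = 0" "cinner b e = 0"
      using assms cinner_commute_zero[of b e]
      by (simp_all add: b_def c_def cinner_diff_right cinner_scale_right)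
    show False
    proof (cases "b = 0")
      case True
      then have "g x = g e"
        using x c assms by (simp add: g_scale)
      then show False
        using 0 assms by (simp add: q_g g_nonzero)
    next
      case False
      obtain \<alpha> \<beta> where ab: "g x = \<alpha> *s g (c *s e) + \<beta> *s g b"
        using g_split[of "c *s e" b] False assms c b x by (metis cinner_scale_left mult_zero_right vector_mul_eq_0)
      then have "\<alpha> = 0"
        using 0 c assms b False by (simp add: g_scale matrix_vector_right_distrib matrix_vector_mult_scale q_g_orthogonal q_g g_nonzero)
      then have "same b (b + c *s e)"
        using ab x by (auto simp: same_def add.commute)
      then show False
        using not_same_orthogonal[of b "c *s e"] False assms c b by (simp add: cinner_scale_right)
    qed
  qed
qed (use assms in \<open>simp add: q_g_orthogonal\<close>)

section \<open>Coordinates of images and their ratios\<close>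

lemma axis_nth: "axis i a $ j = (if j = i then a else 0)"
  by (simp add: axis_def)

abbreviation e :: "'n \<Rightarrow> complex^'n" where
  "e i \<equiv> axis i 1"

text \<open>Here \<open>1\<close> is the all-ones vector. It plays the part of the unit point of a
  projective frame: it fixes the scale of each basis vector so that its own image has all
  coordinates 1.\<close>

definition frame_vec :: "'n \<Rightarrow> complex^'n" where
  "frame_vec i = q (e i) *v g 1"

definition T :: "complex^'n^'n" where
  "T = (\<chi> i j. frame_vec j $ i)"

definition coord :: "complex^'n \<Rightarrow> complex^'n" where
  "coord x = matrix_inv T *v g x"

lemma q_axis_frame_vec: "q (e i) *v frame_vec j = (if i = j then frame_vec j else 0)"
  by (auto simp: frame_vec_def q_idem q_orthogonal axis_nth)

lemma frame_vec_nonzero: "frame_vec i \<noteq> 0"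
proof -
  have "(1 :: complex^'n) \<noteq> 0"
    by (metis one_index zero_index zero_neq_one)
  then show ?thesis
    by (simp add: frame_vec_def q_g_eq_0_iff)
qed

lemma T_mult: "T *v v = (\<Sum>j\<in>UNIV. v $ j *s frame_vec j)"
proof -
  have "column j T = frame_vec j" for j
    by (simp add: T_def column_def vec_eq_iff)
  then show ?thesis
    using matrix_mult_sum[of T v] by simp
qed

lemma q_axis_T: "q (e i) *v (T *v v) = v $ i *s frame_vec i"
proof -
  have "q (e i) *v (T *v v) = (\<Sum>j\<in>UNIV. v $ j *s (if i = j then frame_vec j else 0))"
    by (simp add: T_mult matrix_vector_mult_sum_right matrix_vector_mult_scale q_axis_frame_vec)
  then show ?thesis
    by (simp add: if_distrib[of "\<lambda>x. _ *s x"] cong: if_cong)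
qed

lemma invertible_T: "invertible T"
  unfolding invertible_iff_trivial_kernel
proof safe
  fix v assume "T *v v = 0"
  then have "v $ i = 0" for i
    using q_axis_T[of i v] frame_vec_nonzero by simp
  then show "v = 0"
    by (simp add: vec_eq_iff)
qed

lemma T_coord [simp]: "T *v coord x = g x"
  by (simp add: coord_def matrix_vector_mul_assoc invertible_matrix_inv invertible_T)

lemma T_inj: "T *v v = T *v w \<longleftrightarrow> v = w"
  by (metis invertible_T invertible_matrix_inv(2) matrix_vector_mul_assoc matrix_vector_mul_lid)

lemma q_axis_g: "q (e i) *v g x = coord x $ i *s frame_vec i"
  using q_axis_T[of i "coord x"] by simp

lemma coord_eq_0_iff: "x \<noteq> 0 \<Longrightarrow> coord x $ i = 0 \<longleftrightarrow> x $ i = 0"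
  using q_g_eq_0_iff[of "e i" x] frame_vec_nonzero[of i] by (simp add: q_axis_g)

lemma coord_one: "coord 1 $ i = 1"
  using q_axis_g[of i 1] frame_vec_nonzero[of i] unfolding frame_vec_def[symmetric]
  by (metis vector_mul_rcancel vector_smult_lid)

lemma coord_combination: "g x = \<alpha> *s g a + \<beta> *s g b \<Longrightarrow> coord x = \<alpha> *s coord a + \<beta> *s coord b"
  by (simp add: coord_def matrix_vector_right_distrib matrix_vector_mult_scale)

definition ratio :: "'n \<Rightarrow> 'n \<Rightarrow> complex \<Rightarrow> complex" where
  "ratio i j s = coord (e i + s *s e j) $ j / coord (e i + s *s e j) $ i"

lemma axis_add_nonzero: "i \<noteq> j \<Longrightarrow> e i + s *s e j \<noteq> (0 :: complex^'n)"
  using add_orthogonal_nonzero[of "e i" "e j" s] by (simp add: axis_nth)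

text \<open>Split x into its part supported on {i, j}, a multiple of \<open>p\<close>, and the rest.
  The parts are orthogonal, and the image of the rest has vanishing i-th and j-th coordinates, so
  these two coordinates of the image of x are proportional to those for \<open>p\<close>.\<close>

lemma coord_ratio:
  assumes "x \<noteq> 0" "x $ i \<noteq> 0" "i \<noteq> j"
  shows "coord x $ j = coord x $ i * ratio i j (x $ j / x $ i)"
proof -
  define s where "s = x $ j / x $ i"
  define p where "p = e i + s *s e j"
  define a b where "a = x $ i *s p" "b = x - a"
  have p: "p \<noteq> 0"
    using axis_add_nonzero assms by (simp add: p_def)
  have a: "a \<noteq> 0" "g a = g p"
    using p assms by (simp_all add: a_b_def g_scale)
  have ax: "a $ k = (if k = i then x $ i else if k = j then x $ j else 0)" for k
    using assms by (simp add: a_b_def p_def s_def axis_nth)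
  have b: "b $ i = 0" "b $ j = 0"
    using assms by (simp_all add: a_b_def(2) ax)
  have "\<exists>\<alpha>. coord x $ i = \<alpha> * coord p $ i \<and> coord x $ j = \<alpha> * coord p $ j"
  proof (cases "b = 0")
    case True
    then have "coord x = coord p"
      using a by (simp add: a_b_def(2) coord_def)
    then show ?thesis
      by (metis mult_1)
  next
    case False
    have "cinner a b = 0"
      unfolding cinner_def by (intro sum.neutral) (auto simp: ax b)
    then obtain \<alpha> \<beta> where "g x = \<alpha> *s g a + \<beta> *s g b"
      using g_split[of a b] a False by (metis a_b_def(2) add.commute diff_add_cancel)
    then have "coord x = \<alpha> *s coord p + \<beta> *s coord b"
      using coord_combination a by metis
    moreover have "coord b $ i = 0" "coord b $ j = 0"
      using b False by (simp_all add: coord_eq_0_iff)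
    ultimately show ?thesis
      by auto
  qed
  moreover have "coord p $ i \<noteq> 0"
    using p assms by (simp add: coord_eq_0_iff) (simp add: p_def axis_nth)
  ultimately show ?thesis
    by (auto simp: ratio_def p_def s_def[symmetric])
qed

lemma ratio_one: "i \<noteq> j \<Longrightarrow> ratio i j 1 = 1"
  using coord_ratio[of 1 i j] coord_one by (metis div_by_1 mult_1 one_index zero_index zero_neq_one)

lemma ratio_zero: "i \<noteq> j \<Longrightarrow> ratio i j 0 = 0"
  by (simp add: ratio_def coord_eq_0_iff) (simp add: axis_nth)

text \<open>Read off three ratios of the image of one vector with coordinates 1, s, s t at i, j,
  k.\<close>

lemma ratio_mult:
  assumes "i \<noteq> j" "j \<noteq> k" "i \<noteq> k"
  shows "ratio i j s * ratio j k t = ratio i k (s * t)"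
proof (cases "s = 0")
  case False
  define x where "x = e i + s *s e j + (s * t) *s e k"
  have x: "x $ i = 1" "x $ j = s" "x $ k = s * t"
    using assms by (simp_all add: x_def axis_nth)
  then have "x \<noteq> 0"
    by auto
  then have "coord x $ j = coord x $ i * ratio i j s" "coord x $ k = coord x $ j * ratio j k t"
    "coord x $ k = coord x $ i * ratio i k (s * t)" "coord x $ i \<noteq> 0"
    using coord_ratio[of x i j] coord_ratio[of x j k] coord_ratio[of x i k] x assms False
    by (simp_all add: coord_eq_0_iff)
  then show ?thesis
    by (simp add: mult.assoc)
qed (use assms in \<open>simp add: ratio_zero\<close>)

lemma ratio_const:
  assumes "i \<noteq> j" "i' \<noteq> j'"
  shows "ratio i j s = ratio i' j' s"
proof -
  have right: "ratio i j s = ratio i k s" if "i \<noteq> j" "i \<noteq> k" for i j k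
    using ratio_mult[of i j k s 1] ratio_one[of j k] that by (cases "j = k") auto
  have left: "ratio i k s = ratio j k s" if "i \<noteq> k" "j \<noteq> k" for i j k
    using ratio_mult[of i j k 1 s] ratio_one[of i j] that by (cases "i = j") auto
  show ?thesis
  proof (cases "i' = j")
    case False
    then show ?thesis
      using left[of i j i'] right[of i' j j'] assms by auto
  next
    \<comment> \<open>The direct route would pass through the pair (j, j), so a third index k is
      inserted: (i, j), (i, k), (j, k), (j, j').\<close>
    case True
    obtain k where "k \<noteq> i" "k \<noteq> j"
      using ex_other_two[OF card3] by metis
    then show ?thesis
      using right[of i j k] left[of i k j] right[of j k j'] assms True by auto
  qed
qed

section \<open>The ratio function is a continuous field endomorphism\<close>

definition h :: "complex \<Rightarrow> complex" where
  "h s = (SOME c. \<forall>i j. i \<noteq> j \<longrightarrow> ratio i j s = c)"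

lemma ratio_eq_h: "i \<noteq> j \<Longrightarrow> ratio i j s = h s"
proof -
  assume "i \<noteq> j"
  have "\<forall>i j. i \<noteq> j \<longrightarrow> ratio i j s = h s"
    unfolding h_def by (rule someI_ex) (metis ratio_const)
  then show ?thesis
    using \<open>i \<noteq> j\<close> by blast
qed

lemma h_mult: "h (s * t) = h s * h t"
proof -
  obtain i j :: 'n where "i \<noteq> j"
    using ex_other_two[OF card3] by metis
  moreover obtain k where "k \<noteq> i" "k \<noteq> j"
    using ex_other_two[OF card3] by metis
  ultimately show ?thesis
    using ratio_mult[of i j k s t] by (simp add: ratio_eq_h)
qed

lemma h_one: "h 1 = 1" and h_zero: "h 0 = 0"
proof -
  obtain i j :: 'n where "i \<noteq> j"
    using ex_other_two[OF card3] by metis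
  then show "h 1 = 1" "h 0 = 0"
    using ratio_one ratio_zero by (metis ratio_eq_h)+
qed

lemma h_eq_0_iff: "h s = 0 \<longleftrightarrow> s = 0"
proof
  assume "h s = 0"
  then have "h (s * (1 / s)) = 0"
    by (simp only: h_mult) simp
  then show "s = 0"
    using h_one by (cases "s = 0") auto
qed (simp add: h_zero)

definition hvec :: "complex^'n \<Rightarrow> complex^'n" where
  "hvec x = (\<chi> i. h (x $ i))"

lemma g_eq_hvec:
  assumes "x \<noteq> 0"
  obtains c where "c \<noteq> 0" "g x = c *s (T *v hvec x)"
proof -
  obtain i where i: "x $ i \<noteq> 0"
    using assms by (auto simp: vec_eq_iff)
  define c where "c = coord x $ i / h (x $ i)"
  have "coord x $ j = c * h (x $ j)" for j
  proof (cases "i = j")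
    case False
    have "h (x $ i) * h (x $ j / x $ i) = h (x $ j)"
      using i by (simp flip: h_mult)
    then show ?thesis
      using coord_ratio[OF assms i False] i
      by (simp add: c_def ratio_eq_h[OF False] h_eq_0_iff field_simps)
  qed (use i in \<open>simp add: c_def h_eq_0_iff\<close>)
  then have "coord x = c *s hvec x"
    by (simp add: vec_eq_iff hvec_def)
  then have "g x = c *s (T *v hvec x)"
    by (metis T_coord matrix_vector_mult_scale)
  moreover have "c \<noteq> 0"
    using i assms by (simp add: c_def coord_eq_0_iff h_eq_0_iff)
  ultimately show thesis
    using that by blast
qed

text \<open>The vectors (1, -y, y) and (0, x, x) at i, j, k are orthogonal for all x and y. So the
  image of their sum is a combination of their images; the i-th coordinate normalizes the first
  coefficient, and the contribution of the second vector is the same at j and k.\<close>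

lemma h_orthogonal_relation:
  assumes "x \<noteq> 0"
  shows "h (x - y) - h (- y) = h (x + y) - h y"
proof -
  obtain i j :: 'n where ij: "i \<noteq> j"
    using ex_other_two[OF card3] by metis
  obtain k where k: "k \<noteq> i" "k \<noteq> j"
    using ex_other_two[OF card3] by metis
  define a :: "complex^'n" where "a = e i + (- y) *s e j + y *s e k"
  define b :: "complex^'n" where "b = x *s e j + x *s e k"
  have a: "a $ i = 1" "a $ j = - y" "a $ k = y" and b: "b $ i = 0" "b $ j = x" "b $ k = x"
    using ij k by (auto simp: a_def b_def axis_nth)
  have "b = x *s (e j + 1 *s e k)"
    by (simp add: b_def vector_add_ldistrib)
  then have "cinner a b = x * (cnj (a $ j) + cnj (a $ k))"
    by (simp add: cinner_add_right cinner_scale_right distrib_left)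
  then have orth: "cinner a b = 0"
    by (simp add: a)
  have nz: "a \<noteq> 0" "b \<noteq> 0"
    using a b assms by (metis zero_index zero_neq_one, metis zero_index)
  then have "a + b \<noteq> 0"
    using add_orthogonal_nonzero[of a b 1] orth by simp
  obtain \<alpha> \<beta> where "g (a + b) = \<alpha> *s g a + \<beta> *s g b"
    using g_split nz orth by metis
  moreover obtain c1 where "g a = c1 *s (T *v hvec a)"
    using g_eq_hvec nz by metis
  moreover obtain c2 where "g b = c2 *s (T *v hvec b)"
    using g_eq_hvec nz by metis
  moreover obtain c3 where c3: "c3 \<noteq> 0" "g (a + b) = c3 *s (T *v hvec (a + b))"
    using g_eq_hvec \<open>a + b \<noteq> 0\<close> by metis
  ultimately have "T *v (c3 *s hvec (a + b)) = T *v ((\<alpha> * c1) *s hvec a + (\<beta> * c2) *s hvec b)"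
    by (simp add: matrix_vector_right_distrib matrix_vector_mult_scale vector_smult_assoc)
  then have eq: "c3 *s hvec (a + b) = (\<alpha> * c1) *s hvec a + (\<beta> * c2) *s hvec b"
    by (simp only: T_inj)
  have 1: "c3 = \<alpha> * c1"
    using arg_cong[OF eq, of "\<lambda>v. v $ i"] by (simp add: hvec_def a b h_one h_zero)
  have "c3 * h (x - y) = \<alpha> * c1 * h (- y) + \<beta> * c2 * h x"
    using arg_cong[OF eq, of "\<lambda>v. v $ j"] by (simp add: hvec_def a b)
  moreover have "c3 * h (x + y) = \<alpha> * c1 * h y + \<beta> * c2 * h x"
    using arg_cong[OF eq, of "\<lambda>v. v $ k"] by (simp add: hvec_def a b add.commute)
  ultimately have "c3 * (h (x - y) - h (- y)) = c3 * (h (x + y) - h y)"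
    by (simp add: 1 algebra_simps)
  then show ?thesis
    using c3 by simp
qed

text \<open>The square of the value is 1, and the value 1 would give the orthogonal vectors e_i +
  e_j and e_i - e_j the same image.\<close>

lemma h_minus_one: "h (- 1) = - 1"
proof -
  have "h (- 1) * h (- 1) = 1"
    by (simp add: h_one flip: h_mult)
  then have "(h (- 1) - 1) * (h (- 1) + 1) = 0"
    by (simp add: algebra_simps)
  moreover have "h (- 1) \<noteq> 1"
  proof
    assume h: "h (- 1) = 1"
    obtain i j :: 'n where ij: "i \<noteq> j"
      using ex_other_two[OF card3] by metis
    define a b where "a = e i + 1 *s e j" "b = e i + (- 1) *s e j"
    have nz: "a \<noteq> 0" "b \<noteq> 0"
      unfolding a_b_def using axis_add_nonzero[OF ij] by blast+
    have "cinner a b = 0"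
      using ij by (simp add: a_b_def cinner_add_right cinner_scale_right cinner_diff_right axis_nth)
    moreover have "hvec a = hvec b"
      using ij by (simp add: hvec_def a_b_def vec_eq_iff axis_nth h h_one)
    then have "same a b"
      using g_eq_hvec[OF nz(1)] g_eq_hvec[OF nz(2)] unfolding same_def
      by (metis vector_smult_assoc nonzero_divide_eq_eq)
    ultimately show False
      using nz same_not_orthogonal by blast
  qed
  ultimately show ?thesis
    by (simp add: eq_neg_iff_add_eq_0)
qed

lemma h_add: "h (x + y) = h x + h y"
proof (cases "x = 0 \<or> y = 0")
  case False
  have minus: "h (- z) = - h z" for z
    using h_mult[of "- 1" z] by (simp add: h_minus_one)
  \<comment> \<open>As \<open>h\<close> is odd, the relation yields this difference; with x and y
    exchanged it yields the sum below.\<close>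
  have 1: "h (x + y) - h (x - y) = 2 * h y"
    using h_orthogonal_relation[of x y] False by (simp add: minus algebra_simps)
  have 2: "h (x + y) + h (x - y) = 2 * h x"
    using h_orthogonal_relation[of y x] False minus[of "x - y"] by (simp add: minus algebra_simps)
  have "2 * h (x + y) = 2 * (h x + h y)"
    using 1 2 by (simp add: algebra_simps)
  then show ?thesis
    by (simp only: mult_cancel_left) simp
qed (auto simp: h_zero)

text \<open>Since \<open>g\<close> may jump, the ratio is computed from another vector on the same
  image line: \<open>q (e i + s *s e j)\<close> applied to a fixed vector is continuous in s, and it
  never vanishes because e_i is not orthogonal to e_i + s e_j.\<close>

lemma continuous_h: "continuous_on UNIV h"
proof -
  obtain i j :: 'n where ij: "i \<noteq> j"
    using ex_other_two[OF card3] by metis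
  define M where "M s = matrix_inv T *v (q (e i + s *s e j) *v frame_vec i)" for s
  have nz: "e i + s *s e j \<noteq> 0" for s
    using axis_add_nonzero[OF ij] .
  have M: "M s $ i \<noteq> 0 \<and> M s $ j = h s * M s $ i" for s
  proof -
    obtain c where c: "frame_vec i = c *s g (e i)"
      using q_range[of "e i" "g 1"] by (auto simp: frame_vec_def)
    then have "c \<noteq> 0"
      using frame_vec_nonzero[of i] by auto
    have "cinner (e i + s *s e j) (e i) \<noteq> 0"
      using ij by (simp add: cinner_add_left cinner_scale_left axis_nth)
    then have "q (e i + s *s e j) *v frame_vec i \<noteq> 0"
      using nz \<open>c \<noteq> 0\<close> by (simp add: c matrix_vector_mult_scale q_g_eq_0_iff)
    moreover obtain d where "q (e i + s *s e j) *v frame_vec i = d *s g (e i + s *s e j)"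
      using q_range nz by blast
    ultimately have d: "d \<noteq> 0" "M s = d *s coord (e i + s *s e j)"
      by (auto simp: M_def coord_def matrix_vector_mult_scale)
    have "coord (e i + s *s e j) $ i \<noteq> 0"
      using nz ij by (simp add: coord_eq_0_iff) (simp add: axis_nth)
    then show ?thesis
      using d ratio_eq_h[OF ij, of s] by (simp add: ratio_def field_simps)
  qed
  then have "h = (\<lambda>s. M s $ j / M s $ i)"
    by (auto simp: fun_eq_iff)
  moreover have "continuous_on UNIV M"
    unfolding M_def[abs_def] by (intro continuous_intros) (rule nz)
  then have "continuous_on UNIV (\<lambda>s. M s $ j / M s $ i)"
    using M by (intro continuous_intros) auto
  ultimately show ?thesis
    by simp
qed

lemma frame_map_form:
  obtains "\<And>u. norm u = 1 \<Longrightarrow> Q u *v (T *v u) = T *v u"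
  | "\<And>u. norm u = 1 \<Longrightarrow> Q u *v (T *v (\<chi> i. cnj (u $ i))) = T *v (\<chi> i. cnj (u $ i))"
proof -
  have Q: "Q u *v (T *v hvec u) = T *v hvec u" if "norm u = 1" for u
  proof -
    have "u \<noteq> 0"
      using that by auto
    then obtain c where c: "c \<noteq> 0" "g u = c *s (T *v hvec u)"
      using g_eq_hvec by metis
    have "q u *v g u = g u"
      using q_g \<open>u \<noteq> 0\<close> by simp
    then show ?thesis
      using c that by (simp add: q_def normalize_vec_unit matrix_vector_mult_scale)
  qed
  have "h = (\<lambda>z. z) \<or> h = cnj"
    by (intro continuous_field_endomorphism continuous_h h_add h_mult h_one)
  then show thesis
  proof
    assume "h = (\<lambda>z. z)"
    then have "hvec u = u" for u
      by (simp add: hvec_def)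
    then show thesis
      using Q that(1) by simp
  next
    assume "h = cnj"
    then show thesis
      using Q that(2) by (simp add: hvec_def)
  qed
qed

end

subsection \<open>Conjugations and transpose conjugations\<close>

lemma spectrum_iff_not_invertible: "c \<in> spectrum A \<longleftrightarrow> \<not> invertible (A - mat c)"
  by (auto simp: spectrum_def invertible_iff_trivial_kernel matrix_vector_mult_diff_rdistrib)

lemma spectrum_transpose: "spectrum (mat_transpose A) = spectrum A"
  for A :: "complex^'a^'a"
proof -
  have "mat_transpose (A - mat c) = mat_transpose A - mat c" for c
    by (simp add: vec_eq_iff Finite_Cartesian_Product.transpose_def mat_def)
  moreover have inv: "invertible (mat_transpose M)" if "invertible M" for M :: "complex^'a^'a"
    using that unfolding invertible_def by (metis matrix_transpose_mul transpose_mat)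
  have "invertible (mat_transpose M) \<longleftrightarrow> invertible M" for M :: "complex^'a^'a"
    using inv[of M] inv[of "mat_transpose M"] by auto
  ultimately show ?thesis
    by (metis (no_types, lifting) set_eqI spectrum_iff_not_invertible)
qed

lemma spectrum_similar:
  fixes T :: "complex^'n^'n"
  assumes "invertible T"
  shows "spectrum (T ** A ** matrix_inv T) = spectrum A"
proof -
  have sub: "spectrum A \<subseteq> spectrum (T ** A ** T')" if "T' ** T = mat 1" for A T T' :: "complex^'n^'n"
  proof
    fix c assume "c \<in> spectrum A"
    then obtain v where v: "v \<noteq> 0" "A *v v = c *s v"
      by (auto simp: spectrum_def)
    have "(T ** A ** T') *v (T *v v) = T *v (A *v ((T' ** T) *v v))"
      by (simp only: matrix_vector_mul_assoc matrix_mul_assoc)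
    then have "(T ** A ** T') *v (T *v v) = c *s (T *v v)"
      by (simp add: that v(2) matrix_vector_mult_scale)
    moreover have "T *v v \<noteq> 0"
      using v(1) that by (metis matrix_vector_mul_assoc matrix_vector_mul_lid matrix_vector_mult_0_right)
    ultimately show "c \<in> spectrum (T ** A ** T')"
      by (auto simp: spectrum_def)
  qed
  have "matrix_inv T ** (T ** A ** matrix_inv T) ** T = (matrix_inv T ** T) ** A ** (matrix_inv T ** T)"
    by (simp only: matrix_mul_assoc)
  then have "matrix_inv T ** (T ** A ** matrix_inv T) ** T = A"
    by (simp add: invertible_matrix_inv assms)
  then show ?thesis
    using sub[of "matrix_inv T" T A] sub[of T "matrix_inv T" "T ** A ** matrix_inv T"]
    by (simp add: invertible_matrix_inv assms subset_antisym)
qed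

lemma conjugation_mult:
  fixes T :: "complex^'n^'n"
  assumes "invertible T"
  shows "(T ** A ** matrix_inv T) ** (T ** B ** matrix_inv T) = T ** (A ** B) ** matrix_inv T"
proof -
  have "(T ** A ** matrix_inv T) ** (T ** B ** matrix_inv T) = T ** A ** (matrix_inv T ** T) ** B ** matrix_inv T"
    by (simp only: matrix_mul_assoc)
  then show ?thesis
    by (simp add: invertible_matrix_inv assms matrix_mul_assoc)
qed

lemma CS_preserver_conjugation:
  fixes T :: "complex^'n^'n"
  assumes "invertible T"
  shows "CS_preserver Z (\<lambda>A. T ** A ** matrix_inv T)"
    and "CS_preserver Z (\<lambda>A. T ** mat_transpose A ** matrix_inv T)"
  unfolding CS_preserver_def
  by (auto simp: spectrum_similar spectrum_transpose conjugation_mult assms simp flip: matrix_transpose_mul)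

lemma continuous_on_conjugation:
  "continuous_on Z (\<lambda>A :: complex^'n^'n. T ** A ** matrix_inv T)"
  "continuous_on Z (\<lambda>A :: complex^'n^'n. T ** mat_transpose A ** matrix_inv T)"
  unfolding Finite_Cartesian_Product.transpose_def
  by (intro continuous_intros)+

lemma CS_preserver_cong:
  assumes "\<And>A. A \<in> Z \<Longrightarrow> \<phi> A = \<psi> A"
  shows "CS_preserver Z \<phi> \<longleftrightarrow> CS_preserver Z \<psi>"
  using assms by (simp add: CS_preserver_def)

lemma eigenbasis_conjugation:
  fixes A M T W :: "complex^'n^'n"
  assumes "invertible T" "invertible W"
    and "\<And>j. A *v column j W = x j *s column j W"
    and "\<And>j. M *v (T *v column j W) = x j *s (T *v column j W)"
  shows "M = T ** A ** matrix_inv T"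
proof (rule matrix_eq_on_columns[of "T ** W"])
  show "invertible (T ** W)"
    using assms invertible_mult by blast
  fix j
  have "(T ** A ** matrix_inv T) *v (T *v column j W) = T *v (A *v ((matrix_inv T ** T) *v column j W))"
    by (simp only: matrix_vector_mul_assoc matrix_mul_assoc)
  then show "M *v column j (T ** W) = (T ** A ** matrix_inv T) *v column j (T ** W)"
    by (simp add: matrix_mult_column assms invertible_matrix_inv matrix_vector_mult_scale)
qed

theorem theorem1p3:
  fixes X :: "complex set"
    and \<phi> :: "complex^'n^'n \<Rightarrow> complex^'n^'n"
  assumes "CARD('n) \<ge> 3"
    and "perfect_set X"
    and "\<forall>x \<in> (config_space X :: (complex^'n) set). contains_cycle CARD('n) (point_graph X x)"
    and "transitive_on_components (config_space X :: (complex^'n) set)"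
    and "\<not> free_on_components (config_space X :: (complex^'n) set)"
  shows "(continuous_on (normal_matrices X) \<phi> \<and> CS_preserver (normal_matrices X) \<phi>) \<longleftrightarrow>
    (\<exists>T :: complex^'n^'n. invertible T \<and>
       ((\<forall>A \<in> normal_matrices X. \<phi> A = T ** A ** matrix_inv T) \<or>
        (\<forall>A \<in> normal_matrices X. \<phi> A = T ** mat_transpose A ** matrix_inv T)))"
proof
  assume \<phi>: "continuous_on (normal_matrices X) \<phi> \<and> CS_preserver (normal_matrices X) \<phi>"
  obtain Q where Q: "continuous_on {u. norm u = 1} Q"
    "\<And>U. unitary U \<Longrightarrow> \<exists>V. invertible V \<and> (\<forall>i j. Q (column i U) *v column j V = (if i = j then column j V else 0))"
    "\<And>U x. unitary U \<Longrightarrow> x \<in> power_space X \<Longrightarrow> \<phi> (unidiag U x) = (\<Sum>i\<in>UNIV. mat (x $ i) ** Q (column i U))"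
    by (rule CS_preserver_frame[OF assms conjunct1[OF \<phi>] conjunct2[OF \<phi>]]) (rule that)
  interpret frame_map Q
    by unfold_locales (fact assms Q)+
  \<comment> \<open>A vector fixed by one idempotent of a frame is killed by the others, so it is an
    eigenvector of the image.\<close>
  have \<phi>_eigen: "\<phi> (unidiag U x) *v w = x $ j *s w"
    if "unitary U" "x \<in> power_space X" "Q (column j U) *v w = w" for U x j w
  proof -
    have "Q (column i U) *v w = (if i = j then w else 0)" for i
      using frame_mult[OF that(1), of i j w] that(3) by auto
    then show ?thesis
      using that by (simp add: Q(3) matrix_vector_mult_sum_left if_distrib[of "\<lambda>x. _ *s x"]
          flip: matrix_vector_mul_assoc cong: if_cong)
  qed
  have unit: "norm (column j U) = 1" if "unitary U" for U :: "complex^'n^'n" and j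
    using that by (simp add: unitary_columns cinner_self_eq_1[symmetric])
  consider "\<And>u. norm u = 1 \<Longrightarrow> Q u *v (T *v u) = T *v u"
    | "\<And>u. norm u = 1 \<Longrightarrow> Q u *v (T *v (\<chi> i. cnj (u $ i))) = T *v (\<chi> i. cnj (u $ i))"
    using frame_map_form by blast
  then show "\<exists>T :: complex^'n^'n. invertible T \<and>
       ((\<forall>A \<in> normal_matrices X. \<phi> A = T ** A ** matrix_inv T) \<or>
        (\<forall>A \<in> normal_matrices X. \<phi> A = T ** mat_transpose A ** matrix_inv T))"
  proof cases
    case 1
    have "\<phi> A = T ** A ** matrix_inv T" if A: "A \<in> normal_matrices X" for A
    proof -
      obtain U x where U: "unitary U" "x \<in> power_space X" "A = unidiag U x"
        using normal_matricesE[OF A] by metis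
      then show ?thesis
        using 1 unit
        by (intro eigenbasis_conjugation[OF invertible_T unitary_invertible[OF U(1)], of _ "($) x"])
          (simp_all add: unidiag_column \<phi>_eigen)
    qed
    then show ?thesis
      using invertible_T by blast
  next
    case 2
    have "\<phi> A = T ** mat_transpose A ** matrix_inv T" if A: "A \<in> normal_matrices X" for A
    proof -
      obtain U x where U: "unitary U" "x \<in> power_space X" "A = unidiag U x"
        using normal_matricesE[OF A] by metis
      \<comment> \<open>Conjugating A* v = cnj(c) v entrywise gives A^t cnj(v) = c cnj(v), so the
        conjugated columns of U diagonalize the transpose with unchanged eigenvalues.\<close>
      define W where "W = (\<chi> i j. cnj (U $ i $ j))"
      have col: "column j W = (\<chi> i. cnj (column j U $ i))" for j
        by (simp add: W_def column_def)
      have "cinner (column i W) (column j W) = cnj (cinner (column i U) (column j U))" for i j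
        by (simp add: col cinner_def cnj_sum)
      then have "unitary W"
        using U(1) by (simp add: unitary_columns)
      moreover have "mat_transpose A *v column j W = x $ j *s column j W" for j
      proof -
        have "mat_transpose A *v column j W = (\<chi> i. cnj ((conj_transpose A *v column j U) $ i))"
          by (simp only: col matrix_vector_mult_def conj_transpose_def Finite_Cartesian_Product.transpose_def)
            (simp add: cnj_sum)
        also have "conj_transpose A *v column j U = cnj (x $ j) *s column j U"
          using U by (simp add: conj_transpose_unidiag unidiag_column)
        finally show ?thesis
          by (simp add: col vec_eq_iff)
      qed
      ultimately show ?thesis
        using 2 unit U
        by (intro eigenbasis_conjugation[OF invertible_T unitary_invertible, of W _ "($) x"])
          (simp_all add: \<phi>_eigen col)
    qed
    then show ?thesis
      using invertible_T by blast
  qed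
next
  assume "\<exists>T :: complex^'n^'n. invertible T \<and>
       ((\<forall>A \<in> normal_matrices X. \<phi> A = T ** A ** matrix_inv T) \<or>
        (\<forall>A \<in> normal_matrices X. \<phi> A = T ** mat_transpose A ** matrix_inv T))"
  then obtain T :: "complex^'n^'n" where T: "invertible T"
    and "(\<forall>A \<in> normal_matrices X. \<phi> A = T ** A ** matrix_inv T) \<or>
        (\<forall>A \<in> normal_matrices X. \<phi> A = T ** mat_transpose A ** matrix_inv T)"
    by blast
  then consider "\<And>A. A \<in> normal_matrices X \<Longrightarrow> \<phi> A = T ** A ** matrix_inv T"
    | "\<And>A. A \<in> normal_matrices X \<Longrightarrow> \<phi> A = T ** mat_transpose A ** matrix_inv T"
    by blast
  then show "continuous_on (normal_matrices X) \<phi> \<and> CS_preserver (normal_matrices X) \<phi>"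
  proof cases
    case 1
    then show ?thesis
      using continuous_on_conjugation(1) CS_preserver_conjugation(1)[OF T]
      by (metis (no_types, lifting) CS_preserver_cong continuous_on_cong)
  next
    case 2
    then show ?thesis
      using continuous_on_conjugation(2) CS_preserver_conjugation(2)[OF T]
      by (metis (no_types, lifting) CS_preserver_cong continuous_on_cong)
  qed
qed

end
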